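(* Let $w$ be a solution, not identically zero, of the Airy equation $w''(z)=z\,w(z)$. If $w$ is not a constant multiple of one of the three functions ${\rm Ai}(z)$, ${\rm Ai}(z e^{2\pi i/3})$, ${\rm Ai}(z e^{-2\pi i/3})$, then $w$ has zeros tending asymptotically to each of the three rays $\arg z=-\pi$, $\arg z=\pi/3$ and $\arg z=-\pi/3$. The functions ${\rm Ai}(z)$, ${\rm Ai}(z e^{2\pi i/3})$ and ${\rm Ai}(z e^{-2\pi i/3})$ are exceptions: they only have zeros on one ray, namely on $\arg z=\pi$, $\arg z=\pi/3$ and $\arg z=-\pi/3$, respectively.
   Context: ${\rm Ai}$ denotes the standard Airy function of the first kind. The ray $\arg z=\phi$ is the half-line $\{re^{i\phi}: r>0\}$; the rays $\arg z=\pi$ and $\arg z=-\pi$ both denote the negative real axis. A function has zeros tending asymptotically to a ray if there is an infinite sequence $(z_n)$ of zeros with $|z_n|\to\infty$ whose distance to the ray tends to $0$. *)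

theory Defs
  imports "HOL-Analysis.Analysis"
begin

definition airy_solution :: "(complex \<Rightarrow> complex) \<Rightarrow> bool" where
  "airy_solution w \<longleftrightarrow> w holomorphic_on UNIV \<and> (\<forall>z. (deriv ^^ 2) w z = z * w z)"

(* Maclaurin series of the Airy function (Abramowitz-Stegun 10.4.2-10.4.5, DLMF 9.4.1),
   with Ai(0) = 3^(-2/3) / Gamma(2/3) and Ai'(0) = - 3^(-1/3) / Gamma(1/3). *)
definition airy_Ai :: "complex \<Rightarrow> complex" where
  "airy_Ai z =
     of_real (3 powr (-2/3) / Gamma (2/3)) *
       (\<Sum>k. 3 ^ k * pochhammer (1/3) k * z ^ (3 * k) / fact (3 * k))
     - of_real (3 powr (-1/3) / Gamma (1/3)) *
       (\<Sum>k. 3 ^ k * pochhammer (2/3) k * z ^ (3 * k + 1) / fact (3 * k + 1))"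

definition ray :: "real \<Rightarrow> complex set" where
  "ray \<phi> = {of_real r * cis \<phi> | r. r > 0}"

definition zeros_tend_to_ray :: "(complex \<Rightarrow> complex) \<Rightarrow> real \<Rightarrow> bool" where
  "zeros_tend_to_ray w \<phi> \<longleftrightarrow>
     (\<exists>zs :: nat \<Rightarrow> complex.
        (\<forall>n. w (zs n) = 0) \<and>
        filterlim (\<lambda>n. norm (zs n)) at_top sequentially \<and>
        (\<lambda>n. infdist (zs n) (ray \<phi>)) \<longlonglongrightarrow> 0)"

(* Zeros exist on the ray (a sequence of them going to infinity) and nowhere else. *)
definition zeros_only_on_ray :: "(complex \<Rightarrow> complex) \<Rightarrow> real \<Rightarrow> bool" where
  "zeros_only_on_ray w \<phi> \<longleftrightarrow> zeros_tend_to_ray w \<phi> \<and> {z. w z = 0} \<subseteq> ray \<phi>"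

end

theory Submission
  imports Defs "HOL-Complex_Analysis.Complex_Analysis"
begin

text \<open>
Write $\omega = e^{2\pi i/3}$. The equation $w'' = zw$ is invariant under $z \mapsto \omega z$, so a
statement about one of the three rays is a statement about the negative axis for a rotated solution,
and it is enough to show that a solution which is not a multiple of ${\rm Ai}(\omega z)$ or
${\rm Ai}(\omega^2 z)$ has zeros approaching the negative axis.

On the negative axis, $z = -x$, every solution is asymptotically a superposition of two waves,
$x^{-1/4}(\alpha e^{i\zeta} + \beta e^{-i\zeta})$ with $\zeta = \frac23 x^{3/2}$. The absolute
values of the two amplitudes converge along $x = n^4$ (\<open>lg_amplitude_norm_convergent\<close>).
If both limits are nonzero, then rescaling $w$ around $-x$ by the local wavelength $x^{-1/2}$ gives
functions that converge, along a subsequence, to a superposition of $e^{ih}$ and $e^{-ih}$ with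
nonzero coefficients. The limit has a zero, so by Hurwitz $w$ has a zero at distance
$O(x^{-1/2})$ from $-x$; this is \<open>zeros_near_negative_axis\<close>. The Wronskian can be read off the
amplitudes, hence the solutions lacking a given one of the two waves form at most a line
(\<open>wronskian_zero_if_lg_vanishes\<close>, \<open>multiple_if_wronskian_zero\<close>).

It remains to recognise the two lines. This is done by locating zeros rather than by
expanding ${\rm Ai}$ asymptotically. The zeros of ${\rm Ai}$ are all negative (\<open>airy_Ai_zeros\<close>), so the zeros
of ${\rm Ai}(\omega z)$ and ${\rm Ai}(\omega^2 z)$ lie on the rays $\arg z = \pm\pi/3$, far from the
negative axis. Each of the two functions must therefore lack a wave. They cannot lack the same one,
being linearly independent, so between them they exhaust both lines.

That the zeros of ${\rm Ai}$ are negative follows from the self-adjointness of $-d^2/dt^2 + t$: if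
${\rm Ai}(z) = 0$, then $f(t) = {\rm Ai}(z + t)$ vanishes at $0$ and decays for $t \to \infty$,
and integrating $f'' \bar f = (z + t) |f|^2$ forces $z$ to be real and negative. The decay is the one
place where the values of ${\rm Ai}$ and ${\rm Ai}'$ at $0$ matter. It is obtained from
\[ {\rm Ai}(z) = \frac{1}{2\pi i} \bigl(e^{i\pi/3} E(e^{i\pi/3} z) - e^{-i\pi/3} E(e^{-i\pi/3} z)\bigr),
   \qquad E(z) = \int_0^\infty e^{-s^3/3 - zs}\,ds, \]
where $E(z) \to 0$ as ${\rm Re}\, z \to \infty$. The formula (\<open>airy_Ai_laplace\<close>) is proved
by integrating the exponential series term by term, the moments of $e^{-s^3/3}$ being values of
the Gamma function; the factor $2\pi$ appears there as $\sqrt 3\,\Gamma(1/3)\,\Gamma(2/3)$.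
\<close>

section \<open>Rotations and Wronskians of solutions\<close>

lemma airy_solution_DERIV:
  assumes "airy_solution w"
  shows "(w has_field_derivative deriv w z) (at z)"
    and "(deriv w has_field_derivative z * w z) (at z)"
proof -
  have hol: "w holomorphic_on UNIV" and ode: "deriv (deriv w) z = z * w z"
    using assms by (auto simp: airy_solution_def numeral_2_eq_2)
  show "(w has_field_derivative deriv w z) (at z)"
    by (rule holomorphic_derivI[OF hol]) auto
  have "deriv w holomorphic_on UNIV"
    using hol by (intro holomorphic_deriv) auto
  from holomorphic_derivI[OF this, of z] show "(deriv w has_field_derivative z * w z) (at z)"
    by (simp add: ode)
qed

lemma airy_solutionI:
  assumes "\<And>z. (w has_field_derivative w' z) (at z)"
    and "\<And>z. (w' has_field_derivative z * w z) (at z)"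
  shows "airy_solution w" and "deriv w = w'"
proof -
  show D: "deriv w = w'"
    using assms(1) by (auto intro!: ext DERIV_imp_deriv)
  have "w holomorphic_on UNIV"
    using assms(1) by (auto simp: holomorphic_on_open)
  moreover have "(deriv ^^ 2) w z = z * w z" for z
    using assms(2)[of z] by (simp add: numeral_2_eq_2 D DERIV_imp_deriv)
  ultimately show "airy_solution w"
    by (simp add: airy_solution_def)
qed

lemma airy_solution_rotate:
  assumes "airy_solution w" "c ^ 3 = 1"
  shows "airy_solution (\<lambda>z. w (z * c))"
    and "deriv (\<lambda>z. w (z * c)) = (\<lambda>z. c * deriv w (z * c))"
proof -
  note [derivative_intros] = DERIV_chain2[OF airy_solution_DERIV(1)[OF assms(1)]]
    DERIV_chain2[OF airy_solution_DERIV(2)[OF assms(1)]]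
  have c3: "c * (z * c * x * c) = z * x" for z x
  proof -
    have "c * (z * c * x * c) = c ^ 3 * (z * x)"
      by (simp add: power3_eq_cube algebra_simps)
    then show ?thesis using assms(2) by simp
  qed
  have 1: "((\<lambda>z. w (z * c)) has_field_derivative c * deriv w (z * c)) (at z)" for z
    by (auto intro!: derivative_eq_intros)
  have 2: "((\<lambda>z. c * deriv w (z * c)) has_field_derivative z * w (z * c)) (at z)" for z
    by (rule derivative_eq_intros refl)+ (use c3[of z "w (z * c)"] in \<open>simp add: mult_ac\<close>)
  show "airy_solution (\<lambda>z. w (z * c))" "deriv (\<lambda>z. w (z * c)) = (\<lambda>z. c * deriv w (z * c))"
    using airy_solutionI[OF 1 2] by auto
qed

definition wronskian :: "(complex \<Rightarrow> complex) \<Rightarrow> (complex \<Rightarrow> complex) \<Rightarrow> complex \<Rightarrow> complex" where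
  "wronskian f g z = f z * deriv g z - deriv f z * g z"

lemma wronskian_constant:
  assumes "airy_solution f" "airy_solution g"
  shows "wronskian f g z = wronskian f g 0"
proof -
  have "(wronskian f g has_field_derivative 0) (at z)" for z
    unfolding wronskian_def [abs_def]
    by (rule derivative_eq_intros airy_solution_DERIV assms refl)+ (simp add: algebra_simps)
  then show ?thesis
    using has_field_derivative_zero_constant[of UNIV "wronskian f g"]
    by (metis UNIV_I convex_UNIV)
qed

text \<open>
The determinant with rows $(f, g, k)$, $(f, g, k)$, $(f', g', k')$ vanishes. Expanded along its first
row, it is a linear relation between $f$, $g$ and $k$ whose coefficients are the three constant
Wronskians. The auxiliary solution $k$ thus replaces a uniqueness theorem for the initial value
problem.
\<close>

lemma multiple_if_wronskian_zero:
  assumes "airy_solution f" "airy_solution g" "airy_solution k"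
    and "wronskian f g 0 = 0" "wronskian g k 0 \<noteq> 0"
  shows "\<exists>c. \<forall>z. f z = c * g z"
proof (intro exI allI)
  fix z
  have "f z * wronskian g k z + g z * wronskian k f z + k z * wronskian f g z = 0"
    by (simp add: wronskian_def algebra_simps)
  then have "f z * wronskian g k 0 + g z * wronskian k f 0 = 0"
    using wronskian_constant[of _ _ z] assms by auto
  then show "f z = (- wronskian k f 0 / wronskian g k 0) * g z"
    using assms(5) by (simp add: field_simps eq_neg_iff_add_eq_0)
qed

section \<open>Amplitudes of the two waves on the negative axis\<close>

text \<open>
These are Liouville--Green variables at the point $-x$ with $x = t^4$; the parameter $t = x^{1/4}$
makes all coefficients rational. For $y(x) = w(-x)$ put $u = x^{1/4} y$ and
$V = x^{-1/4} y' + \frac14 x^{-5/4} y$, so that $V$ is the derivative of $u$ with respect to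
$\zeta = \frac23 x^{3/2}$. For $s = i$ and $s = -i$, the amplitude $u - sV$ isolates the wave
$e^{s\zeta}$. Without the second term of $V$, the two amplitudes would be coupled with strength
$1/(4x)$, which is not integrable.
\<close>

definition lg_amplitude :: "complex \<Rightarrow> (complex \<Rightarrow> complex) \<Rightarrow> complex \<Rightarrow> complex" where
  "lg_amplitude s w t = t * w (- (t ^ 4)) - s * (w (- (t ^ 4)) / (4 * t ^ 5) - deriv w (- (t ^ 4)) / t)"

lemma lg_amplitude_sum:
  "lg_amplitude s w t + lg_amplitude (- s) w t = 2 * (t * w (- (t ^ 4)))"
  by (simp add: lg_amplitude_def)

lemma lg_amplitude_wronskian:
  assumes "t \<noteq> 0"
  shows "lg_amplitude s f t * lg_amplitude (- s) g t - lg_amplitude (- s) f t * lg_amplitude s g t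
    = - 2 * s * wronskian f g (- (t ^ 4))"
  using assms by (simp add: lg_amplitude_def wronskian_def field_simps power_numeral_reduce)

text \<open>
The first term is pure rotation, because $s$ is imaginary. The coupling between the two waves is
the second term, and $t^{-7}$ is integrable at infinity.
\<close>

lemma lg_amplitude_DERIV:
  assumes w: "airy_solution w" and s: "s\<^sup>2 = -1" and t: "t \<noteq> 0"
  shows "(lg_amplitude s w has_field_derivative
    4 * s * t ^ 5 * lg_amplitude s w t + 5 / 4 * s / t ^ 7 * (t * w (- (t ^ 4)))) (at t)"
proof -
  define a b where "a = w (- (t ^ 4))" and "b = deriv w (- (t ^ 4))"
  have Dw: "((\<lambda>t. w (- (t ^ 4))) has_field_derivative - 4 * t ^ 3 * b) (at t)"
    unfolding b_def
    by (rule DERIV_cong[OF DERIV_chain2[OF airy_solution_DERIV(1)[OF w]]])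
      (auto intro!: derivative_eq_intros)
  have Dd: "((\<lambda>t. deriv w (- (t ^ 4))) has_field_derivative 4 * t ^ 7 * a) (at t)"
    unfolding a_def
    by (rule DERIV_cong[OF DERIV_chain2[OF airy_solution_DERIV(2)[OF w]]])
      (auto intro!: derivative_eq_intros simp: power_numeral_reduce)
  have D0: "((\<lambda>t. 4 * t ^ 5) has_field_derivative 20 * t ^ 4) (at t)"
    by (auto intro!: derivative_eq_intros)
  have D1: "((\<lambda>t. w (- (t ^ 4)) / (4 * t ^ 5)) has_field_derivative
      - b / t ^ 2 - 5 / 4 * a / t ^ 6) (at t)"
    by (rule DERIV_cong[OF DERIV_divide[OF Dw D0]])
      (use t in \<open>simp_all add: field_simps power_numeral_reduce a_def\<close>)
  have D2: "((\<lambda>t. deriv w (- (t ^ 4)) / t) has_field_derivative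
      4 * t ^ 6 * a - b / t ^ 2) (at t)"
    by (rule DERIV_cong[OF DERIV_divide[OF Dd DERIV_ident]])
      (use t in \<open>simp_all add: field_simps power_numeral_reduce b_def\<close>)
  have D3: "((\<lambda>t. t * w (- (t ^ 4))) has_field_derivative a - 4 * t ^ 4 * b) (at t)"
    by (rule DERIV_cong[OF DERIV_mult[OF DERIV_ident Dw]])
      (simp_all add: field_simps power_numeral_reduce a_def)
  have alg: "a - 4 * t ^ 4 * b - s * (- b / t ^ 2 - 5 / 4 * a / t ^ 6 - (4 * t ^ 6 * a - b / t ^ 2))
      = 4 * s * t ^ 5 * (t * a - s * (a / (4 * t ^ 5) - b / t)) + 5 / 4 * s / t ^ 7 * (t * a)"
  proof -
    have 1: "s * t ^ 5 * (s * (a / (4 * t ^ 5) - b / t)) = - (a / 4 - t ^ 4 * b)"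
    proof -
      have "s * t ^ 5 * (s * (a / (4 * t ^ 5) - b / t)) = s\<^sup>2 * (t ^ 5 * (a / (4 * t ^ 5) - b / t))"
        by (simp only: power2_eq_square mult_ac)
      also have "t ^ 5 * (a / (4 * t ^ 5) - b / t) = a / 4 - t ^ 4 * b"
        using t by (simp add: field_simps power_numeral_reduce)
      finally show ?thesis by (simp add: s)
    qed
    have 2: "5 / 4 * s / t ^ 7 * (t * a) = s * (5 / 4 * a / t ^ 6)"
      using t by (simp add: field_simps power_numeral_reduce)
    have 3: "t ^ 5 * (t * a) = t ^ 6 * a"
      by (simp add: power_numeral_reduce)
    show ?thesis
      using 1 2 3 by algebra
  qed
  have "(lg_amplitude s w has_field_derivative
      a - 4 * t ^ 4 * b - s * (- b / t ^ 2 - 5 / 4 * a / t ^ 6 - (4 * t ^ 6 * a - b / t ^ 2))) (at t)"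
    unfolding lg_amplitude_def [abs_def]
    by (intro DERIV_diff DERIV_cmult D1 D2 D3)
  moreover have "lg_amplitude s w t = t * a - s * (a / (4 * t ^ 5) - b / t)"
    by (simp only: lg_amplitude_def a_def b_def)
  ultimately show ?thesis
    by (simp only: alg flip: a_def)
qed

lemma lg_amplitude_sq_DERIV:
  fixes t :: real
  assumes w: "airy_solution w" and s: "s \<in> {\<i>, - \<i>}" and t: "t > 0"
  obtains D where
    "((\<lambda>t. (cmod (lg_amplitude s w (of_real t)))\<^sup>2) has_real_derivative D) (at t)"
    "\<bar>D\<bar> \<le> 5 / 2 / t ^ 7 * ((cmod (lg_amplitude \<i> w (of_real t)))\<^sup>2 + (cmod (lg_amplitude (- \<i>) w (of_real t)))\<^sup>2)"
proof -
  define P U where "P = (\<lambda>s. lg_amplitude s w (of_real t))" and "U = of_real t * w (- (of_real t ^ 4))"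
  define Q where "Q = 5 / 4 * s / of_real t ^ 7 * U"
  have "s\<^sup>2 = -1" using s by auto
  then have "(lg_amplitude s w has_field_derivative 4 * s * of_real t ^ 5 * P s + Q) (at (of_real t))"
    unfolding P_def Q_def U_def using lg_amplitude_DERIV[OF w, of s "of_real t"] t by simp
  then have "((\<lambda>t. lg_amplitude s w (of_real t)) has_vector_derivative 4 * s * of_real t ^ 5 * P s + Q) (at t)"
    by (rule has_vector_derivative_real_field)
  from bounded_bilinear.has_vector_derivative[OF bounded_bilinear_inner this this]
  have D: "((\<lambda>t. (cmod (lg_amplitude s w (of_real t)))\<^sup>2) has_real_derivative
      2 * (P s \<bullet> (4 * s * of_real t ^ 5 * P s + Q))) (at t)"
    unfolding power2_norm_eq_inner has_real_derivative_iff_has_vector_derivative P_def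
    by (simp only: inner_commute[of _ "lg_amplitude s w (of_real t)"] mult_2)
  have rot: "P s \<bullet> (4 * s * of_real t ^ 5 * P s) = 0"
  proof -
    have "P s \<bullet> (4 * s * of_real t ^ 5 * P s) = 4 * t ^ 5 * (P s \<bullet> (s * P s))"
      by (simp add: inner_complex_def algebra_simps flip: of_real_power)
    also have "P s \<bullet> (s * P s) = 0"
      using s by (auto simp: inner_complex_def)
    finally show ?thesis by simp
  qed
  have nU: "cmod U \<le> (cmod (P \<i>) + cmod (P (- \<i>))) / 2"
  proof -
    have "U = (P \<i> + P (- \<i>)) / 2"
      using lg_amplitude_sum[of \<i> w "of_real t"] by (simp add: P_def U_def)
    then have "cmod U = cmod (P \<i> + P (- \<i>)) / 2"
      by (simp only: norm_divide norm_numeral)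
    then show ?thesis
      using norm_triangle_ineq[of "P \<i>" "P (- \<i>)"] by simp
  qed
  have nQ: "cmod Q = 5 / 4 / t ^ 7 * cmod U"
    using s t by (auto simp: Q_def norm_mult norm_divide norm_power)
  have "\<bar>P s \<bullet> Q\<bar> \<le> cmod (P s) * cmod Q"
    by (rule Cauchy_Schwarz_ineq2)
  also have "\<dots> = 5 / 4 / t ^ 7 * (cmod (P s) * cmod U)"
    by (simp add: nQ)
  also have "\<dots> \<le> 5 / 4 / t ^ 7 * ((cmod (P \<i>))\<^sup>2 + (cmod (P (- \<i>)))\<^sup>2)"
  proof (rule mult_left_mono)
    have lin: "(a + p) / 2 \<le> a + b" if "2 * p \<le> a + b" "0 \<le> a" "0 \<le> b" for a b p :: real
    proof -
      have "a + p \<le> (a + b) * 2"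
        using that by (simp add: algebra_simps)
      then show ?thesis by (simp add: field_simps)
    qed
    have am_gm: "x * ((x + y) / 2) \<le> x\<^sup>2 + y\<^sup>2" for x y :: real
    proof -
      have "2 * (x * y) \<le> x\<^sup>2 + y\<^sup>2"
        using sum_squares_bound[of x y] by (simp only: mult.assoc)
      then have "(x\<^sup>2 + x * y) / 2 \<le> x\<^sup>2 + y\<^sup>2"
        by (rule lin) auto
      then show ?thesis
        by (simp add: power2_eq_square algebra_simps)
    qed
    have "cmod (P s) * cmod U \<le> cmod (P s) * ((cmod (P \<i>) + cmod (P (- \<i>))) / 2)"
      by (intro mult_left_mono nU) auto
    also have "\<dots> \<le> (cmod (P \<i>))\<^sup>2 + (cmod (P (- \<i>)))\<^sup>2"
      using s am_gm[of "cmod (P \<i>)" "cmod (P (- \<i>))"] am_gm[of "cmod (P (- \<i>))" "cmod (P \<i>)"]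
      by (auto simp: add.commute)
    finally show "cmod (P s) * cmod U \<le> (cmod (P \<i>))\<^sup>2 + (cmod (P (- \<i>)))\<^sup>2" .
  qed (use t in simp)
  finally show ?thesis
    using that[OF D] rot by (simp add: inner_add_right P_def)
qed

text \<open>
Gronwall: the sum $N$ of the two squares satisfies $|N'| \le 5 t^{-7} N$, so that
$N e^{t^{-6}}$ is nonincreasing.
\<close>

lemma lg_amplitude_bounded:
  assumes w: "airy_solution w"
  obtains B where "\<And>t::real. t \<ge> 1 \<Longrightarrow>
    (cmod (lg_amplitude \<i> w (of_real t)))\<^sup>2 + (cmod (lg_amplitude (- \<i>) w (of_real t)))\<^sup>2 \<le> B"
proof
  define N where "N = (\<lambda>t::real. (cmod (lg_amplitude \<i> w (of_real t)))\<^sup>2 + (cmod (lg_amplitude (- \<i>) w (of_real t)))\<^sup>2)"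
  fix t :: real assume t: "t \<ge> 1"
  have "N t * exp (1 / t ^ 6) \<le> N 1 * exp (1 / 1 ^ 6)"
  proof (rule DERIV_nonpos_imp_nonincreasing[OF t])
    fix x :: real assume x: "1 \<le> x" "x \<le> t"
    obtain D1 where D1: "((\<lambda>t. (cmod (lg_amplitude \<i> w (of_real t)))\<^sup>2) has_real_derivative D1) (at x)"
       "\<bar>D1\<bar> \<le> 5 / 2 / x ^ 7 * N x"
      using lg_amplitude_sq_DERIV[OF w, of "\<i>" x] x by (auto simp: N_def)
    obtain D2 where D2: "((\<lambda>t. (cmod (lg_amplitude (- \<i>) w (of_real t)))\<^sup>2) has_real_derivative D2) (at x)"
       "\<bar>D2\<bar> \<le> 5 / 2 / x ^ 7 * N x"
      using lg_amplitude_sq_DERIV[OF w, of "- \<i>" x] x by (auto simp: N_def)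
    have DN: "(N has_real_derivative D1 + D2) (at x)"
      unfolding N_def by (intro DERIV_add D1 D2)
    have DE: "((\<lambda>t. exp (1 / t ^ 6)) has_real_derivative - (6 / x ^ 7) * exp (1 / x ^ 6)) (at x)"
      using x by (auto intro!: derivative_eq_intros simp: field_simps power_numeral_reduce)
    have "0 \<le> N x / x ^ 7"
      using x by (simp add: N_def)
    then have "(D1 + D2) - 6 / x ^ 7 * N x \<le> 0"
      using D1(2) D2(2) by (simp add: abs_le_iff)
    then have "((D1 + D2) - 6 / x ^ 7 * N x) * exp (1 / x ^ 6) \<le> 0"
      by (simp add: mult_nonpos_nonneg)
    moreover have "((\<lambda>t. N t * exp (1 / t ^ 6)) has_real_derivative
        ((D1 + D2) - 6 / x ^ 7 * N x) * exp (1 / x ^ 6)) (at x)"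
      by (rule DERIV_cong[OF DERIV_mult[OF DN DE]]) (simp add: algebra_simps)
    ultimately show "\<exists>y. ((\<lambda>t. N t * exp (1 / t ^ 6)) has_real_derivative y) (at x) \<and> y \<le> 0"
      by blast
  qed
  moreover have "N t * 1 \<le> N t * exp (1 / t ^ 6)"
    using t by (intro mult_left_mono) (auto simp: N_def)
  ultimately show "N t \<le> N 1 * exp 1" by simp
qed

text \<open>
Once the amplitudes are bounded, the derivative of the squared modulus is $O(t^{-7})$. A suitable
multiple of $t^{-6}$ turns the squared modulus into a bounded monotone function.
\<close>

lemma lg_amplitude_norm_convergent:
  assumes w: "airy_solution w" and s: "s \<in> {\<i>, - \<i>}"
  shows "convergent (\<lambda>n. cmod (lg_amplitude s w (of_nat n)))"
proof -
  define F where "F = (\<lambda>t::real. (cmod (lg_amplitude s w (of_real t)))\<^sup>2)"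
  obtain B where B: "\<And>t::real. t \<ge> 1 \<Longrightarrow>
    (cmod (lg_amplitude \<i> w (of_real t)))\<^sup>2 + (cmod (lg_amplitude (- \<i>) w (of_real t)))\<^sup>2 \<le> B"
    using lg_amplitude_bounded[OF w] by blast
  have B0: "B \<ge> 0"
    by (rule order_trans[OF _ B[of 1]]) auto
  have mono: "F a - B / a ^ 6 \<le> F b - B / b ^ 6" if ab: "1 \<le> a" "a \<le> b" for a b
  proof (rule DERIV_nonneg_imp_nondecreasing[OF ab(2)])
    fix x assume x: "a \<le> x" "x \<le> b"
    obtain D where D: "(F has_real_derivative D) (at x)"
       "\<bar>D\<bar> \<le> 5 / 2 / x ^ 7 * ((cmod (lg_amplitude \<i> w (of_real x)))\<^sup>2 + (cmod (lg_amplitude (- \<i>) w (of_real x)))\<^sup>2)"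
      unfolding F_def using lg_amplitude_sq_DERIV[OF w s, of x] x ab by force
    have "\<bar>D\<bar> \<le> 5 / 2 / x ^ 7 * B"
      by (rule order_trans[OF D(2)]) (use x ab in \<open>intro mult_left_mono B; simp\<close>)
    moreover have "0 \<le> B / x ^ 7" using x ab B0 by simp
    ultimately have "0 \<le> D + 6 * B / x ^ 7"
      by (simp add: abs_le_iff)
    moreover have "((\<lambda>t. B / t ^ 6) has_real_derivative - (6 * B / x ^ 7)) (at x)"
      using x ab by (auto intro!: derivative_eq_intros simp: field_simps power_numeral_reduce)
    ultimately show "\<exists>y. ((\<lambda>t. F t - B / t ^ 6) has_real_derivative y) (at x) \<and> 0 \<le> y"
      using DERIV_diff[OF D(1)] by (intro exI conjI) (assumption, simp)
  qed
  define X where "X = (\<lambda>n. F (real (Suc n)) - B / real (Suc n) ^ 6)"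
  have "incseq X"
    unfolding X_def by (intro incseq_SucI mono) auto
  moreover have "X n \<le> B" for n
  proof -
    have "F (real (Suc n)) \<le> B"
      by (rule order_trans[OF _ B[of "real (Suc n)"]]) (use s in \<open>auto simp: F_def\<close>)
    moreover have "0 \<le> B / real (Suc n) ^ 6" using B0 by simp
    ultimately show ?thesis by (simp add: X_def)
  qed
  ultimately obtain L where L: "X \<longlonglongrightarrow> L"
    using incseq_convergent by blast
  have "(\<lambda>n. B / real (Suc n) ^ 6) \<longlonglongrightarrow> 0"
    by real_asymp
  from tendsto_add[OF L this] have "(\<lambda>n. F (real (Suc n))) \<longlonglongrightarrow> L"
    by (simp add: X_def)
  then have "(\<lambda>n. F (real n)) \<longlonglongrightarrow> L"
    by (rule LIMSEQ_imp_Suc)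
  from tendsto_real_sqrt[OF this] show ?thesis
    by (auto simp: F_def convergent_def)
qed

definition lg_vanishes :: "complex \<Rightarrow> (complex \<Rightarrow> complex) \<Rightarrow> bool" where
  "lg_vanishes s w \<longleftrightarrow> (\<lambda>n. lg_amplitude s w (of_nat n)) \<longlonglongrightarrow> 0"

text \<open>
The Wronskian is a $2 \times 2$ determinant of amplitudes. If one row tends to zero while the other
stays bounded, the determinant, being constant, is zero.
\<close>

lemma wronskian_zero_if_lg_vanishes:
  assumes f: "airy_solution f" and g: "airy_solution g" and s: "s \<in> {\<i>, - \<i>}"
    and "lg_vanishes s f" "lg_vanishes s g"
  shows "wronskian f g 0 = 0"
proof -
  have bd: "\<exists>K. \<forall>\<^sub>F n in sequentially. cmod (lg_amplitude (- s) h (of_nat n)) \<le> K"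
    if "airy_solution h" for h
  proof -
    have "Bseq (\<lambda>n. cmod (lg_amplitude (- s) h (of_nat n)))"
      using s lg_amplitude_norm_convergent[OF that, of "- s"] convergent_imp_Bseq by auto
    then obtain K where "\<forall>n. cmod (lg_amplitude (- s) h (of_nat n)) \<le> K"
      by (auto simp: Bseq_def)
    then show ?thesis
      by (intro exI[of _ K] always_eventually)
  qed
  obtain Kf Kg where K: "\<forall>\<^sub>F n in sequentially. cmod (lg_amplitude (- s) f (of_nat n)) \<le> Kf"
      "\<forall>\<^sub>F n in sequentially. cmod (lg_amplitude (- s) g (of_nat n)) \<le> Kg"
    using bd[OF f] bd[OF g] by blast
  have "(\<lambda>n. lg_amplitude s f (of_nat n) * lg_amplitude (- s) g (of_nat n)
      - lg_amplitude (- s) f (of_nat n) * lg_amplitude s g (of_nat n)) \<longlonglongrightarrow> 0 - 0"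
    using assms(4,5) unfolding lg_vanishes_def
    by (intro tendsto_diff lim_null_mult_right_bounded[OF _ K(2)] lim_null_mult_left_bounded[OF K(1)])
  moreover have "eventually (\<lambda>n. lg_amplitude s f (of_nat n) * lg_amplitude (- s) g (of_nat n)
      - lg_amplitude (- s) f (of_nat n) * lg_amplitude s g (of_nat n) = - 2 * s * wronskian f g 0) sequentially"
    using eventually_gt_at_top[of 0]
  proof eventually_elim
    case (elim n)
    then have "complex_of_nat n \<noteq> 0" by simp
    from lg_amplitude_wronskian[OF this, of s f g]
    show ?case by (simp add: wronskian_constant[OF f g, of "- (of_nat n ^ 4)"])
  qed
  ultimately have "(\<lambda>n::nat. - 2 * s * wronskian f g 0) \<longlonglongrightarrow> 0 - 0"
    by (rule Lim_transform_eventually)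
  then have "- 2 * s * wronskian f g 0 = 0 - 0"
    by (rule LIMSEQ_unique[OF tendsto_const])
  then show ?thesis
    using s by auto
qed

section \<open>Zeros forced by two surviving waves\<close>

text \<open>
Variation of constants for $f'' = (\epsilon h - 1) f$: the coefficients $c_{\pm i}(h)$ of $f$ with
respect to $e^{ih}$ and $e^{-ih}$ have derivatives of size $|\epsilon h f|$. On a disc of radius $R$
they differ from their values at $0$ by at most half of their maximum $K$ once $\epsilon$ is small.
This gives $K \le 2 K_0$, which bounds the difference in terms of the initial data.
\<close>

lemma perturbed_oscillator:
  fixes f f' :: "complex \<Rightarrow> complex" and \<epsilon> :: complex
  assumes Df: "\<And>h. (f has_field_derivative f' h) (at h)"
    and Df': "\<And>h. (f' has_field_derivative (\<epsilon> * h - 1) * f h) (at h)"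
    and K0: "cmod (f' 0 + \<i> * f 0) \<le> K0" "cmod (f' 0 - \<i> * f 0) \<le> K0"
    and R: "R \<ge> 0" "cmod \<epsilon> * R\<^sup>2 * exp (2 * R) \<le> 1 / 2"
    and h: "cmod h \<le> R"
  shows "cmod (f h - (exp (\<i> * h) * (f' 0 + \<i> * f 0) - exp (- \<i> * h) * (f' 0 - \<i> * f 0)) / (2 * \<i>))
    \<le> exp R * (cmod \<epsilon> * R\<^sup>2 * exp (2 * R) * (2 * K0))"
proof -
  define c where "c = (\<lambda>s h. exp (- s * h) * (f' h + s * f h))"
  have f_eq: "f h = (exp (\<i> * h) * c \<i> h - exp (- \<i> * h) * c (- \<i>) h) / (2 * \<i>)" for h
    by (simp add: c_def field_simps flip: exp_add)
  have Dc: "(c s has_field_derivative exp (- s * h) * (\<epsilon> * h * f h)) (at h)"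
    if "s \<in> {\<i>, - \<i>}" for s h
    unfolding c_def
    by (rule derivative_eq_intros Df Df' refl)+ (use that in \<open>auto simp: algebra_simps\<close>)
  have exp_le: "cmod (exp (- s * h)) \<le> exp R" if "s \<in> {\<i>, - \<i>}" "cmod h \<le> R" for s h
    by (rule order_trans[OF norm_exp]) (use that in \<open>auto simp: norm_mult\<close>)
  have exp_le': "cmod (exp (\<i> * h)) \<le> exp R" "cmod (exp (- \<i> * h)) \<le> exp R" if "cmod h \<le> R" for h
    using exp_le[of "- \<i>" h] exp_le[of \<i> h] that by simp_all
  have comb: "cmod ((exp (\<i> * h) * x - exp (- \<i> * h) * y) / (2 * \<i>)) \<le> exp R * k"
    if "cmod h \<le> R" "cmod x \<le> k" "cmod y \<le> k" for h x y k
  proof -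
    have "cmod (exp (\<i> * h) * x - exp (- \<i> * h) * y) \<le> cmod (exp (\<i> * h) * x) + cmod (exp (- \<i> * h) * y)"
      by (rule norm_triangle_ineq4)
    also have "\<dots> \<le> exp R * k + exp R * k"
      unfolding norm_mult by (intro add_mono mult_mono exp_le' that) auto
    finally show ?thesis by (simp add: norm_divide norm_mult mult_ac)
  qed
  \<comment> \<open>The maximum over the disc is attained, which makes an absorption argument possible in place of
    a differential inequality.\<close>
  define k where "k = (\<lambda>h. max (cmod (c \<i> h)) (cmod (c (- \<i>) h)))"
  have cont_c: "continuous_on UNIV (c s)" if "s \<in> {\<i>, - \<i>}" for s
    by (rule DERIV_continuous_on[of UNIV], rule Dc[OF that])
  have "continuous_on (cball 0 R) k"
    unfolding k_def by (intro continuous_intros continuous_on_subset[OF cont_c]) auto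
  then obtain h1 where h1: "h1 \<in> cball 0 R" "\<And>h. h \<in> cball 0 R \<Longrightarrow> k h \<le> k h1"
    using continuous_attains_sup[of "cball 0 R" k] R(1) by fastforce
  define K where "K = k h1"
  define \<delta> where "\<delta> = cmod \<epsilon> * R\<^sup>2 * exp (2 * R) * K"
  have cK: "cmod (c s h) \<le> K" if "s \<in> {\<i>, - \<i>}" "cmod h \<le> R" for s h
    using h1(2)[of h] that by (auto simp: K_def k_def)
  have "K \<ge> 0"
    by (rule order_trans[OF norm_ge_zero cK[of \<i> 0]]) (use R in auto)
  have var: "cmod (c s h - c s 0) \<le> \<delta>" if s: "s \<in> {\<i>, - \<i>}" and hR: "cmod h \<le> R" for s h
  proof -
    have "cmod (c s h - c s 0) \<le> (exp R * (cmod \<epsilon> * R * (exp R * K))) * cmod (h - 0)"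
    proof (rule field_differentiable_bound[of "cball 0 R"])
      fix z assume "z \<in> cball (0::complex) R"
      then have z: "cmod z \<le> R" by simp
      show "(c s has_field_derivative exp (- s * z) * (\<epsilon> * z * f z)) (at z within cball 0 R)"
        using Dc[OF s] DERIV_subset by blast
      have "cmod (f z) \<le> exp R * K"
        unfolding f_eq[of z] by (intro comb z cK) auto
      then show "cmod (exp (- s * z) * (\<epsilon> * z * f z)) \<le> exp R * (cmod \<epsilon> * R * (exp R * K))"
        unfolding norm_mult by (intro mult_mono exp_le[OF s z, unfolded norm_mult] z) (use R in auto)
    qed (use R hR in auto)
    also have "\<dots> \<le> (exp R * (cmod \<epsilon> * R * (exp R * K))) * R"
      using hR R \<open>K \<ge> 0\<close> by (intro mult_left_mono) auto
    also have "\<dots> = \<delta>"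
      unfolding \<delta>_def exp_double[of R] by (simp only: power2_eq_square mult_ac)
    finally show ?thesis .
  qed
  have "\<delta> \<le> 1 / 2 * K"
    unfolding \<delta>_def using R(2) \<open>K \<ge> 0\<close> by (rule mult_right_mono)
  have "cmod (c s h1) \<le> K0 + K / 2" if s: "s \<in> {\<i>, - \<i>}" for s
  proof -
    have "cmod (c s h1) \<le> cmod (c s 0) + cmod (c s h1 - c s 0)"
      by (metis add.commute diff_add_cancel norm_triangle_ineq)
    moreover have "cmod (c s 0) \<le> K0" using K0 s by (auto simp: c_def)
    moreover have "cmod (c s h1 - c s 0) \<le> \<delta>" using var[OF s, of h1] h1 by simp
    ultimately show ?thesis using \<open>\<delta> \<le> 1 / 2 * K\<close> by simp
  qed
  then have "K \<le> K0 + K / 2"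
    by (simp add: K_def k_def)
  then have "\<delta> \<le> cmod \<epsilon> * R\<^sup>2 * exp (2 * R) * (2 * K0)"
    unfolding \<delta>_def by (intro mult_left_mono) auto
  moreover have "cmod (f h - (exp (\<i> * h) * c \<i> 0 - exp (- \<i> * h) * c (- \<i>) 0) / (2 * \<i>)) \<le> exp R * \<delta>"
  proof -
    have "f h - (exp (\<i> * h) * c \<i> 0 - exp (- \<i> * h) * c (- \<i>) 0) / (2 * \<i>)
        = (exp (\<i> * h) * (c \<i> h - c \<i> 0) - exp (- \<i> * h) * (c (- \<i>) h - c (- \<i>) 0)) / (2 * \<i>)"
      by (subst f_eq) (simp add: field_simps)
    then show ?thesis
      using comb[OF h var[OF _ h] var[OF _ h], of \<i> "- \<i>"] by simp
  qed
  ultimately show ?thesis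
    by (simp add: c_def) (smt (verit) exp_gt_zero mult_left_mono)
qed

lemma ray_neg: "ray (- pi) = {- of_real r | r. r > 0}"
  by (auto simp: ray_def complex_eq_iff)

lemma zeros_tend_to_rayI:
  assumes "\<And>N. \<exists>z. w z = 0 \<and> real N \<le> norm z \<and> infdist z (ray \<phi>) \<le> 1 / real (Suc N)"
  shows "zeros_tend_to_ray w \<phi>"
proof -
  obtain zs where zs: "\<And>N. w (zs N) = 0" "\<And>N. real N \<le> norm (zs N)"
      "\<And>N. infdist (zs N) (ray \<phi>) \<le> 1 / real (Suc N)"
    using assms by metis
  have "filterlim (\<lambda>n. norm (zs n)) at_top sequentially"
    using filterlim_at_top_mono[OF filterlim_real_sequentially] zs(2) by auto
  moreover have "(\<lambda>n. infdist (zs n) (ray \<phi>)) \<longlonglongrightarrow> 0"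
    using zs(3)
    by (intro tendsto_sandwich[OF _ _ tendsto_const LIMSEQ_inverse_real_of_nat] always_eventually)
      (auto simp: infdist_nonneg inverse_eq_divide)
  ultimately show ?thesis
    unfolding zeros_tend_to_ray_def using zs(1) by blast
qed

lemma oscillation_has_zero:
  assumes "a \<noteq> 0" "b \<noteq> 0"
  obtains h0 where "exp (\<i> * h0) * a - exp (- \<i> * h0) * b = 0"
    and "exp (\<i> * (h0 + 1)) * a - exp (- \<i> * (h0 + 1)) * b \<noteq> 0"
proof -
  define h0 where "h0 = Ln (b / a) / (2 * \<i>)"
  have "exp (\<i> * h0) ^ 2 = b / a"
    using assms by (simp add: h0_def flip: exp_double)
  then have *: "exp (\<i> * h0) * exp (\<i> * h0) * a = b"
    using assms by (simp add: power2_eq_square field_simps)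
  have 1: "exp (\<i> * h0) * a - exp (- \<i> * h0) * b = 0"
    using * by (simp add: exp_minus field_simps)
  have "exp (\<i> * (h0 + 1)) * a - exp (- \<i> * (h0 + 1)) * b
      = exp (\<i> * h0) * a * (exp \<i> - exp (- \<i>))"
    using 1 by (simp add: exp_add exp_diff algebra_simps exp_minus divide_inverse)
  moreover have "exp \<i> - exp (- \<i>) \<noteq> 0"
  proof -
    have "exp \<i> - exp (- \<i>) = 2 * \<i> * of_real (sin 1)"
      by (simp add: complex_eq_iff Re_exp Im_exp)
    moreover have "sin 1 \<noteq> (0::real)"
      using sin_gt_zero_02[of 1] by simp
    ultimately show ?thesis by simp
  qed
  ultimately show ?thesis
    using that[OF 1] assms by simp
qed


text \<open>
The rescaled function $f_n(h) = n\, w(-n^4 + h/n^2)$ satisfies the oscillator equation with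
$\epsilon = n^{-6}$, and the initial coefficients of its two exponentials are, up to constant factors
and an error $O(n^{-6})$, the two amplitudes of $w$ at $-n^4$. Their phases need not converge, but
a subsequence does, and the limit has a zero in a fixed disc. If $w$ had no zeros far out near
the negative axis, the $f_n$ would eventually have none in that disc, contradicting Hurwitz.
\<close>

lemma zeros_near_negative_axis:
  assumes w: "airy_solution w" and "\<not> lg_vanishes \<i> w" "\<not> lg_vanishes (- \<i>) w"
  shows "zeros_tend_to_ray w (- pi)"
proof (rule zeros_tend_to_rayI, rule ccontr)
  fix N
  assume "\<nexists>z. w z = 0 \<and> real N \<le> norm z \<and> infdist z (ray (- pi)) \<le> 1 / real (Suc N)"
  then have no_zero: "w z \<noteq> 0" if "real N \<le> norm z" "infdist z (ray (- pi)) \<le> 1 / real (Suc N)" for z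
    using that by blast
  define f where "f = (\<lambda>n h. of_nat n * w (- (of_nat n ^ 4) + h / of_nat n ^ 2))"
  define f' where "f' = (\<lambda>n h. deriv w (- (of_nat n ^ 4) + h / of_nat n ^ 2) / of_nat n)"
  have Df: "(f n has_field_derivative f' n h) (at h)"
    and Df': "(f' n has_field_derivative (1 / of_nat n ^ 6 * h - 1) * f n h) (at h)" if "n > 0" for n h
  proof -
    have Da: "((\<lambda>h. - (of_nat n ^ 4) + h / of_nat n ^ 2) has_field_derivative 1 / of_nat n ^ 2) (at h)"
      by (rule DERIV_cong[OF DERIV_add[OF DERIV_const DERIV_cdivide[OF DERIV_ident]]]) (simp)
    show "(f n has_field_derivative f' n h) (at h)"
      unfolding f_def f'_def
      by (rule DERIV_cong[OF DERIV_cmult[OF DERIV_chain2[OF airy_solution_DERIV(1)[OF w] Da]]])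
        (use that in \<open>simp add: power2_eq_square\<close>)
    have coeff: "(- (x ^ 4) + h / x ^ 2) * y * (1 / x ^ 2) / x = (1 / x ^ 6 * h - 1) * (x * y)"
      if "x \<noteq> 0" for x y :: complex
      using that by (simp add: field_simps power_numeral_reduce)
    show "(f' n has_field_derivative (1 / of_nat n ^ 6 * h - 1) * f n h) (at h)"
      unfolding f_def f'_def
      by (rule DERIV_cong[OF DERIV_cdivide[OF DERIV_chain2[OF airy_solution_DERIV(2)[OF w] Da]]])
        (rule coeff, use that in simp)
  qed
  have amp_lim: "\<exists>L. L \<noteq> 0 \<and> (\<lambda>n. cmod (lg_amplitude s w (of_nat n))) \<longlonglongrightarrow> L"
    if s: "s \<in> {\<i>, - \<i>}" for s
  proof -
    obtain L where L: "(\<lambda>n. cmod (lg_amplitude s w (of_nat n))) \<longlonglongrightarrow> L"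
      using lg_amplitude_norm_convergent[OF w s] by (auto simp: convergent_def)
    have "\<not> lg_vanishes s w" using s assms by auto
    then have "L \<noteq> 0"
      using L unfolding lg_vanishes_def by (auto simp: tendsto_norm_zero_iff)
    then show ?thesis using L by blast
  qed
  define c where "c = (\<lambda>s n. f' n 0 + s * f n 0)"
  have c_lim: "\<exists>L. L \<noteq> 0 \<and> (\<lambda>n. cmod (c s n)) \<longlonglongrightarrow> L" if s: "s \<in> {\<i>, - \<i>}" for s
  proof -
    \<comment> \<open>The correction is the second term of $V$, expressed by the amplitudes through their sum.\<close>
    have c_eq: "c s n - s * lg_amplitude (- s) w (of_nat n) =
        (lg_amplitude \<i> w (of_nat n) + lg_amplitude (- \<i>) w (of_nat n)) * (1 / (8 * of_nat n ^ 6))"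
      if "n > 0" for n
      using s that
      by (auto simp: c_def f_def f'_def lg_amplitude_def field_simps power_numeral_reduce)
    obtain L where L: "L \<noteq> 0" "(\<lambda>n. cmod (lg_amplitude (- s) w (of_nat n))) \<longlonglongrightarrow> L"
      using amp_lim[of "- s"] s by auto
    have "(\<lambda>n. cmod (c s n) - cmod (lg_amplitude (- s) w (of_nat n))) \<longlonglongrightarrow> 0"
    proof (rule Lim_null_comparison)
      show "\<forall>\<^sub>F n in sequentially. norm (cmod (c s n) - cmod (lg_amplitude (- s) w (of_nat n)))
        \<le> (cmod (lg_amplitude \<i> w (of_nat n)) + cmod (lg_amplitude (- \<i>) w (of_nat n))) * (1 / (8 * real n ^ 6))"
        using eventually_gt_at_top[of 0]
      proof eventually_elim
        case (elim n)
        have "cmod (lg_amplitude (- s) w (of_nat n)) = cmod (s * lg_amplitude (- s) w (of_nat n))"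
          using s by (auto simp: norm_mult)
        then have "norm (cmod (c s n) - cmod (lg_amplitude (- s) w (of_nat n)))
            \<le> cmod (c s n - s * lg_amplitude (- s) w (of_nat n))"
          using norm_triangle_ineq3 by simp
        also have "\<dots> = cmod (lg_amplitude \<i> w (of_nat n) + lg_amplitude (- \<i>) w (of_nat n)) * (1 / (8 * real n ^ 6))"
          unfolding c_eq[OF elim] by (simp add: norm_mult norm_divide norm_power)
        also have "\<dots> \<le> (cmod (lg_amplitude \<i> w (of_nat n)) + cmod (lg_amplitude (- \<i>) w (of_nat n))) * (1 / (8 * real n ^ 6))"
          by (intro mult_right_mono norm_triangle_ineq) auto
        finally show ?case .
      qed
      obtain L1 where L1: "(\<lambda>n. cmod (lg_amplitude \<i> w (of_nat n))) \<longlonglongrightarrow> L1"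
        using amp_lim[of \<i>] by auto
      obtain L2 where L2: "(\<lambda>n. cmod (lg_amplitude (- \<i>) w (of_nat n))) \<longlonglongrightarrow> L2"
        using amp_lim[of "- \<i>"] by auto
      have "(\<lambda>n. 1 / (8 * real n ^ 6)) \<longlonglongrightarrow> 0"
        by real_asymp
      from tendsto_mult[OF tendsto_add[OF L1 L2] this]
      show "(\<lambda>n. (cmod (lg_amplitude \<i> w (of_nat n)) + cmod (lg_amplitude (- \<i>) w (of_nat n)))
          * (1 / (8 * real n ^ 6))) \<longlonglongrightarrow> 0"
        by simp
    qed
    from tendsto_add[OF this L(2)] show ?thesis
      using L(1) by auto
  qed
  have c_bdd: "\<exists>K. \<forall>n. cmod (c s n) \<le> K" if s: "s \<in> {\<i>, - \<i>}" for s
  proof -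
    have "convergent (\<lambda>n. cmod (c s n))"
      using c_lim[OF s] by (auto simp: convergent_def)
    then show ?thesis
      using convergent_imp_Bseq by (fastforce simp: Bseq_def)
  qed
  obtain K1 K2 where K12: "\<And>n. cmod (c \<i> n) \<le> K1" "\<And>n. cmod (c (- \<i>) n) \<le> K2"
    using c_bdd[of \<i>] c_bdd[of "- \<i>"] by auto
  define K where "K = max K1 K2"
  have K: "cmod (c \<i> n) \<le> K" "cmod (c (- \<i>) n) \<le> K" for n
    using K12[of n] by (auto simp: K_def)
  have "bounded (range (\<lambda>n. (c \<i> n, c (- \<i>) n)))"
  proof (rule boundedI)
    fix x assume "x \<in> range (\<lambda>n. (c \<i> n, c (- \<i>) n))"
    then obtain n where "x = (c \<i> n, c (- \<i>) n)" by blast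
    then show "norm x \<le> K + K"
      using norm_Pair_le[of "c \<i> n" "c (- \<i>) n"] K[of n] by simp
  qed
  then obtain l r where r: "strict_mono r" and l: "((\<lambda>n. (c \<i> n, c (- \<i>) n)) \<circ> r) \<longlonglongrightarrow> l"
    using bounded_imp_convergent_subsequence by blast
  define a b where "a = fst l" and "b = snd l"
  have a: "(\<lambda>n. c \<i> (r n)) \<longlonglongrightarrow> a" and b: "(\<lambda>n. c (- \<i>) (r n)) \<longlonglongrightarrow> b"
    using tendsto_fst[OF l] tendsto_snd[OF l] by (simp_all add: a_def b_def o_def)
  have sub_nz: "x \<noteq> 0" if s: "s \<in> {\<i>, - \<i>}" and x: "(\<lambda>n. c s (r n)) \<longlonglongrightarrow> x" for s x
  proof -
    obtain L where L: "L \<noteq> 0" "(\<lambda>n. cmod (c s n)) \<longlonglongrightarrow> L"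
      using c_lim[OF s] by blast
    have "(\<lambda>n. cmod (c s (r n))) \<longlonglongrightarrow> L"
      using LIMSEQ_subseq_LIMSEQ[OF L(2) r] by (simp add: o_def)
    then have "cmod x = L"
      using LIMSEQ_unique tendsto_norm[OF x] by blast
    then show ?thesis using L by auto
  qed
  have "a \<noteq> 0" "b \<noteq> 0" using sub_nz[OF _ a] sub_nz[OF _ b] by auto
  then obtain h0 where h0: "exp (\<i> * h0) * a - exp (- \<i> * h0) * b = 0"
    "exp (\<i> * (h0 + 1)) * a - exp (- \<i> * (h0 + 1)) * b \<noteq> 0"
    by (rule oscillation_has_zero)
  \<comment> \<open>The disc contains both the zero $h_0$ of the limit and the point $h_0 + 1$, where the limit is nonzero;
    so the limit is not constant on it.\<close>
  define R where "R = cmod h0 + 2"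
  have R: "R > 0" by (simp add: R_def add_nonneg_pos)
  define g where "g = (\<lambda>h. (exp (\<i> * h) * a - exp (- \<i> * h) * b) / (2 * \<i>))"
  define \<eta> where "\<eta> = (\<lambda>n. exp R * (1 / real n ^ 6 * R\<^sup>2 * exp (2 * R) * (2 * K))
     + exp R * (cmod (c \<i> n - a) + cmod (c (- \<i>) n - b)))"
  have close: "cmod (f n h - g h) \<le> \<eta> n"
    if n: "n > 0" "1 / real n ^ 6 * R\<^sup>2 * exp (2 * R) \<le> 1 / 2" and h: "cmod h \<le> R" for n h
  proof -
    let ?g = "(exp (\<i> * h) * c \<i> n - exp (- \<i> * h) * c (- \<i>) n) / (2 * \<i>)"
    have ne: "cmod (1 / of_nat n ^ 6) = 1 / real n ^ 6"
      by (simp add: norm_divide norm_power)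
    have 1: "cmod (f n h - ?g) \<le> exp R * (1 / real n ^ 6 * R\<^sup>2 * exp (2 * R) * (2 * K))"
      using perturbed_oscillator[OF Df[OF n(1)] Df'[OF n(1)], of K R h] K[of n] n(2) h R
      unfolding ne by (simp add: c_def)
    have "?g - g h = (exp (\<i> * h) * (c \<i> n - a) - exp (- \<i> * h) * (c (- \<i>) n - b)) / (2 * \<i>)"
      by (simp add: g_def field_simps)
    then have "cmod (?g - g h) = cmod (exp (\<i> * h) * (c \<i> n - a) - exp (- \<i> * h) * (c (- \<i>) n - b)) / 2"
      by (simp add: norm_divide norm_mult)
    also have "\<dots> \<le> cmod (exp (\<i> * h) * (c \<i> n - a) - exp (- \<i> * h) * (c (- \<i>) n - b))"
      by simp
    also have "\<dots> \<le> cmod (exp (\<i> * h) * (c \<i> n - a)) + cmod (exp (- \<i> * h) * (c (- \<i>) n - b))"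
      by (rule norm_triangle_ineq4)
    also have "\<dots> \<le> exp R * cmod (c \<i> n - a) + exp R * cmod (c (- \<i>) n - b)"
      unfolding norm_mult
      by (intro add_mono mult_right_mono order_trans[OF norm_exp]) (use h in \<open>auto simp: norm_mult\<close>)
    finally have 2: "cmod (?g - g h) \<le> exp R * (cmod (c \<i> n - a) + cmod (c (- \<i>) n - b))"
      by (simp add: distrib_left)
    show ?thesis
      using norm_triangle_ineq[of "f n h - ?g" "?g - g h"] 1 2 by (simp add: \<eta>_def)
  qed
  have near: "\<forall>\<^sub>F n in sequentially. n > 0 \<and> 1 / real n ^ 6 * R\<^sup>2 * exp (2 * R) \<le> 1 / 2
      \<and> R / real n ^ 2 \<le> 1 / real (Suc N) \<and> real N \<le> real n ^ 4 - R / real n ^ 2"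
  proof -
    have "(\<lambda>n. 1 / real n ^ 6 * R\<^sup>2 * exp (2 * R)) \<longlonglongrightarrow> 0" by real_asymp
    then have 1: "\<forall>\<^sub>F n in sequentially. 1 / real n ^ 6 * R\<^sup>2 * exp (2 * R) < 1 / 2"
      by (rule order_tendstoD) simp
    have "(\<lambda>n. R / real n ^ 2) \<longlonglongrightarrow> 0" by real_asymp
    then have 2: "\<forall>\<^sub>F n in sequentially. R / real n ^ 2 < 1 / real (Suc N)"
      by (rule order_tendstoD) simp
    have "filterlim (\<lambda>n. real n ^ 4 - R / real n ^ 2) at_top sequentially" by real_asymp
    then have 3: "\<forall>\<^sub>F n in sequentially. real N \<le> real n ^ 4 - R / real n ^ 2"
      by (simp add: filterlim_at_top)
    from 1 2 3 eventually_gt_at_top[of 0] show ?thesis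
      by eventually_elim (simp only: less_imp_le simp_thms)
  qed
  then obtain n0 where n0: "\<And>n. n \<ge> n0 \<Longrightarrow> n > 0 \<and> 1 / real n ^ 6 * R\<^sup>2 * exp (2 * R) \<le> 1 / 2
      \<and> R / real n ^ 2 \<le> 1 / real (Suc N) \<and> real N \<le> real n ^ 4 - R / real n ^ 2"
    unfolding eventually_sequentially by blast
  define \<rho> where "\<rho> = (\<lambda>n. r (n + n0))"
  have \<rho>: "\<rho> n \<ge> n0" for n
    using seq_suble[OF r, of "n + n0"] by (simp add: \<rho>_def)
  have "g h0 \<noteq> 0"
  proof (rule Hurwitz_no_zeros[of "ball 0 R" "\<lambda>n. f (\<rho> n)" g h0])
    show "open (ball (0::complex) R)" "connected (ball (0::complex) R)" by auto
    show "f (\<rho> n) holomorphic_on ball 0 R" for n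
      using Df n0[OF \<rho>[of n]] by (auto simp: holomorphic_on_open)
    show "g holomorphic_on ball 0 R"
      unfolding g_def by (intro holomorphic_intros) auto
    show "h0 \<in> ball 0 R" by (simp add: R_def)
    show "\<not> g constant_on ball 0 R"
    proof
      assume "g constant_on ball 0 R"
      moreover have "h0 + 1 \<in> ball 0 R"
        using norm_triangle_ineq[of h0 1] by (simp add: R_def)
      ultimately have "g h0 = g (h0 + 1)"
        using \<open>h0 \<in> ball 0 R\<close> by (metis constant_on_def)
      then show False using h0 by (simp add: g_def)
    qed
    show "f (\<rho> n) h \<noteq> 0" if h: "h \<in> ball 0 R" for n h
    proof -
      define m where "m = \<rho> n"
      have m: "m > 0" "R / real m ^ 2 \<le> 1 / real (Suc N)" "real N \<le> real m ^ 4 - R / real m ^ 2"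
        using n0[OF \<rho>[of n]] by (auto simp: m_def)
      define z where "z = - (of_nat m ^ 4) + h / of_nat m ^ 2"
      have hm: "cmod (h / of_nat m ^ 2) \<le> R / real m ^ 2"
        using h by (auto simp: norm_divide norm_power divide_right_mono)
      have "w z \<noteq> 0"
      proof (rule no_zero)
        have "cmod (of_nat m ^ 4) \<le> cmod z + cmod (h / of_nat m ^ 2)"
          using norm_triangle_ineq4[of "h / of_nat m ^ 2" z] by (simp add: z_def)
        then show "real N \<le> norm z" using hm m(3) by (simp add: norm_power)
        have "- of_real (real m ^ 4) \<in> ray (- pi)"
          using m(1) unfolding ray_neg by (intro CollectI exI[of _ "real m ^ 4"]) auto
        from infdist_le[OF this, of z] show "infdist z (ray (- pi)) \<le> 1 / real (Suc N)"
          using hm m(2) by (simp add: z_def dist_norm)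
      qed
      then show ?thesis using m(1) by (simp add: f_def z_def flip: m_def)
    qed
    show "uniform_limit S (\<lambda>n. f (\<rho> n)) g sequentially" if "compact S" "S \<subseteq> ball 0 R" for S
    proof (rule uniform_limitI)
      fix e :: real assume "e > 0"
      have "(\<lambda>n. 1 / real n ^ 6) \<longlonglongrightarrow> 0" by real_asymp
      from LIMSEQ_subseq_LIMSEQ[OF this r] have rl: "(\<lambda>n. 1 / real (r n) ^ 6) \<longlonglongrightarrow> 0"
        by (simp add: o_def)
      have "(\<lambda>n. \<eta> (r n)) \<longlonglongrightarrow> exp R * (0 * R\<^sup>2 * exp (2 * R) * (2 * K)) + exp R * (0 + 0)"
        unfolding \<eta>_def using a b
        by (intro tendsto_intros rl) (auto simp: tendsto_norm_zero_iff LIM_zero_iff)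
      then have "(\<lambda>n. \<eta> (\<rho> n)) \<longlonglongrightarrow> 0"
        unfolding \<rho>_def by (intro LIMSEQ_ignore_initial_segment) simp
      then have "\<forall>\<^sub>F n in sequentially. \<eta> (\<rho> n) < e"
        using \<open>e > 0\<close> by (rule order_tendstoD)
      then show "\<forall>\<^sub>F n in sequentially. \<forall>x\<in>S. dist (f (\<rho> n) x) (g x) < e"
      proof eventually_elim
        case (elim n)
        show ?case
        proof
          fix x assume "x \<in> S"
          then have "cmod x \<le> R" using that by force
          then show "dist (f (\<rho> n) x) (g x) < e"
            using close[of "\<rho> n" x] n0[OF \<rho>[of n]] elim by (auto simp: dist_norm)
        qed
      qed
    qed
  qed
  then show False using h0(1) by (simp add: g_def)
qed

section \<open>A Laplace integral whose moments are Gamma values\<close>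

text \<open>
The moments $\int_0^\infty s^n e^{-s^3/3}\,ds$, evaluated by the substitution $t = s^3/3$.
\<close>

definition airy_moment :: "nat \<Rightarrow> real" where
  "airy_moment n = 3 powr ((real n - 2) / 3) * Gamma ((real n + 1) / 3)"

lemma airy_moment_pos: "airy_moment n > 0"
  by (simp add: airy_moment_def Gamma_real_pos)

lemma airy_moment_rec: "airy_moment (n + 3) = real (n + 1) * airy_moment n"
proof -
  have "Gamma ((real n + 1) / 3 + 1) = (real n + 1) / 3 * Gamma ((real n + 1) / 3)"
    by (rule Gamma_plus1, rule notI, drule nonpos_Ints_nonpos) simp
  moreover have "(3::real) powr ((real n - 2) / 3 + 1) = 3 powr ((real n - 2) / 3) * 3"
    by (subst powr_add) simp
  ultimately show ?thesis
    by (simp add: airy_moment_def add_divide_distrib diff_divide_distrib)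
qed

text \<open>
Three steps of the recursion multiply the $n$-th term by $r^3/((n+2)(n+3))$. Hence the terms for the
radius $2r$ are bounded, and those for $r$ are dominated by a geometric series.
\<close>

lemma airy_moment_powser_summable:
  assumes "r \<ge> 0"
  shows "summable (\<lambda>n. airy_moment n / fact n * r ^ n)"
proof -
  define b where "b = (\<lambda>n. airy_moment n / fact n * (2 * r) ^ n)"
  have b_rec: "b (n + 3) = b n * ((2 * r) ^ 3 / (real (n + 2) * real (n + 3)))" for n
  proof -
    have "fact (n + 3) = real (n + 3) * (real (n + 2) * (real (n + 1) * fact n))"
      by (simp add: numeral_3_eq_3)
    then show ?thesis
      unfolding b_def airy_moment_rec
      by (simp add: power_add mult_ac del: of_nat_add)
  qed
  have b_nonneg: "b n \<ge> 0" for n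
    using assms airy_moment_pos[of n] by (simp add: b_def)
  obtain N where N: "(2 * r) ^ 3 \<le> real N"
    using real_arch_simple by blast
  define B where "B = Max (b ` {..N + 3})"
  have bB: "b n \<le> B" for n
  proof (induction n rule: less_induct)
    case (less n)
    show ?case
    proof (cases "n \<le> N + 3")
      case True
      then show ?thesis by (simp add: B_def)
    next
      case False
      define m where "m = n - 3"
      have n: "n = m + 3" "m \<ge> N" using False by (auto simp: m_def)
      have "(2 * r) ^ 3 \<le> real (m + 2) * real (m + 3)"
      proof -
        have "(2 * r) ^ 3 \<le> real (m + 2)" using N n by simp
        also have "\<dots> * 1 \<le> real (m + 2) * real (m + 3)" by (intro mult_left_mono) auto
        finally show ?thesis by simp
      qed
      then have "b m * ((2 * r) ^ 3 / (real (m + 2) * real (m + 3))) \<le> b m * 1"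
        by (intro mult_left_mono b_nonneg) (simp add: divide_le_eq_1)
      also have "\<dots> \<le> B" using less[of m] n by simp
      finally show ?thesis by (simp only: n(1) b_rec)
    qed
  qed
  show ?thesis
  proof (rule summable_comparison_test')
    show "summable (\<lambda>n. B * (1 / 2) ^ n)"
      by (intro summable_mult summable_geometric) auto
    fix n :: nat assume "n \<ge> 0"
    have "airy_moment n / fact n * r ^ n = b n * (1 / 2) ^ n"
      by (simp add: b_def power_mult_distrib power_divide)
    also have "\<dots> \<le> B * (1 / 2) ^ n"
      by (intro mult_right_mono bB) auto
    finally show "norm (airy_moment n / fact n * r ^ n) \<le> B * (1 / 2) ^ n"
      using assms airy_moment_pos[of n] by simp
  qed
qed

text \<open>
The density $e^{-s^3/3}\,ds$ in the variable $t = s^3/3$, so that $s = (3t)^{1/3}$. In this variable the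
moments are literally Gamma integrals.
\<close>

definition airy_weight :: "real \<Rightarrow> real" where
  "airy_weight t = indicator {0..} t * exp (- t) * (3 * t) powr (- 2 / 3)"

lemma airy_weight_measurable [measurable]: "airy_weight \<in> borel_measurable borel"
  unfolding airy_weight_def [abs_def] by measurable

lemma airy_weight_nonneg: "airy_weight t \<ge> 0"
  by (simp add: airy_weight_def)

lemma airy_weight_moment:
  "has_bochner_integral lborel (\<lambda>t. airy_weight t * ((3 * t) powr (1 / 3)) ^ n) (airy_moment n)"
proof -
  define x where "x = (real n + 1) / 3"
  have x: "x > 0" by (simp add: x_def)
  have "has_bochner_integral lborel (\<lambda>t. indicator {0..} t * t powr (x - 1) / exp t) (Gamma x)"
    by (rule has_bochner_integral_nn_integral)
      (use x in \<open>auto simp: Gamma_real_pos less_imp_le simp flip: Gamma_conv_nn_integral_real\<close>)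
  then have "has_bochner_integral lborel
      (\<lambda>t. 3 powr (x - 1) * (indicator {0..} t * t powr (x - 1) / exp t)) (3 powr (x - 1) * Gamma x)"
    by (rule has_bochner_integral_mult_right)
  moreover have "3 powr (x - 1) * (indicator {0..} t * t powr (x - 1) / exp t)
      = airy_weight t * ((3 * t) powr (1 / 3)) ^ n" for t :: real
  proof (cases "t > 0")
    case True
    have "((3 * t) powr (1 / 3)) ^ n = (3 * t) powr (real n * (1 / 3))"
      using True by (intro powr_power) auto
    then have "(3 * t) powr (- 2 / 3) * ((3 * t) powr (1 / 3)) ^ n = (3 * t) powr (- 2 / 3 + real n * (1 / 3))"
      by (simp only: powr_add)
    also have "- 2 / 3 + real n * (1 / 3) = x - 1" by (simp add: x_def field_simps)
    also have "(3 * t) powr (x - 1) = 3 powr (x - 1) * t powr (x - 1)"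
      by (rule powr_mult)
    finally show ?thesis
      using True by (simp add: airy_weight_def exp_minus field_simps)
  next
    case False
    then show ?thesis by (cases "t = 0") (auto simp: airy_weight_def)
  qed
  moreover have "3 powr (x - 1) * Gamma x = airy_moment n"
    by (simp add: airy_moment_def x_def diff_divide_distrib add_divide_distrib)
  ultimately show ?thesis by simp
qed

definition airy_laplace_kernel :: "complex \<Rightarrow> real \<Rightarrow> complex" where
  "airy_laplace_kernel z t = of_real (airy_weight t) * exp (- z * of_real ((3 * t) powr (1 / 3)))"

definition airy_laplace :: "complex \<Rightarrow> complex" where
  "airy_laplace z = (\<integral>t. airy_laplace_kernel z t \<partial>lborel)"

lemma airy_laplace_kernel_measurable [measurable]: "airy_laplace_kernel z \<in> borel_measurable borel"
  unfolding airy_laplace_kernel_def [abs_def] by measurable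

lemma norm_airy_laplace_kernel:
  "cmod (airy_laplace_kernel z t) = airy_weight t * exp (- Re z * (3 * t) powr (1 / 3))"
  by (simp add: airy_laplace_kernel_def norm_mult airy_weight_nonneg)

text \<open>
The exponential series of the kernel may be integrated term by term, since the integrals of the moduli of its terms are
the terms of the moment series at $|z|$.
\<close>

lemma
  shows airy_laplace_kernel_integrable: "integrable lborel (airy_laplace_kernel z)"
    and airy_laplace_sums: "(\<lambda>n. of_real (airy_moment n) / fact n * (- z) ^ n) sums airy_laplace z"
proof -
  define g where "g = (\<lambda>n t. of_real (airy_weight t * ((3 * t) powr (1 / 3)) ^ n) * ((- z) ^ n / fact n))"
  have g_integral: "has_bochner_integral lborel (g n) (of_real (airy_moment n) * ((- z) ^ n / fact n))" for n
    unfolding g_def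
    by (intro has_bochner_integral_mult_left has_bochner_integral_of_real airy_weight_moment)
  have norm_g: "norm (g n t) = airy_weight t * ((3 * t) powr (1 / 3)) ^ n * (cmod z ^ n / fact n)" for n t
    by (simp add: g_def norm_mult norm_divide norm_power airy_weight_nonneg)
  have "has_bochner_integral lborel (\<lambda>t. norm (g n t)) (airy_moment n * (cmod z ^ n / fact n))" for n
    unfolding norm_g by (intro has_bochner_integral_mult_left airy_weight_moment)
  then have int_norm: "(\<integral>t. norm (g n t) \<partial>lborel) = airy_moment n / fact n * cmod z ^ n" for n
    by (simp add: has_bochner_integral_integral_eq)
  have g_sums: "(\<lambda>n. g n t) sums airy_laplace_kernel z t" for t
  proof -
    let ?s = "of_real ((3 * t) powr (1 / 3)) :: complex"
    have "(\<lambda>n. (- z * ?s) ^ n /\<^sub>R fact n) sums exp (- z * ?s)"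
      by (rule exp_converges)
    from sums_mult[OF this, of "of_real (airy_weight t)"]
    have "(\<lambda>n. of_real (airy_weight t) * ((- z * ?s) ^ n /\<^sub>R fact n)) sums airy_laplace_kernel z t"
      by (simp only: airy_laplace_kernel_def)
    moreover have "of_real (airy_weight t) * ((- z * ?s) ^ n /\<^sub>R fact n) = g n t" for n
      unfolding power_mult_distrib g_def scaleR_conv_of_real
      by (simp only: of_real_mult of_real_power of_real_inverse of_real_fact divide_inverse mult_ac)
    ultimately show ?thesis by simp
  qed
  have g_summable: "summable (\<lambda>n. norm (g n t))" for t
  proof -
    have "summable (\<lambda>n. (cmod z * (3 * t) powr (1 / 3)) ^ n /\<^sub>R fact n)"
      by (rule summable_exp_generic)
    from summable_mult[OF this, of "airy_weight t"] show ?thesis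
      unfolding norm_g by (simp add: power_mult_distrib field_simps)
  qed
  have eq: "(\<lambda>t. \<Sum>n. g n t) = airy_laplace_kernel z"
    using g_sums by (auto simp: sums_iff)
  have ig: "integrable lborel (g n)" for n
    using g_integral by (rule integrable.intros)
  have summ: "summable (\<lambda>n. \<integral>t. norm (g n t) \<partial>lborel)"
    unfolding int_norm by (rule airy_moment_powser_summable) simp
  show "integrable lborel (airy_laplace_kernel z)"
    using integrable_suminf[OF ig _ summ] g_summable by (simp add: eq)
  have "(\<lambda>n. integral\<^sup>L lborel (g n)) sums (\<integral>t. (\<Sum>n. g n t) \<partial>lborel)"
    using sums_integral[OF ig _ summ] g_summable by simp
  then show "(\<lambda>n. of_real (airy_moment n) / fact n * (- z) ^ n) sums airy_laplace z"
    unfolding eq airy_laplace_def [symmetric] has_bochner_integral_integral_eq[OF g_integral]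
    by simp
qed

text \<open>
The modulus of the integral is bounded by its value at the real part of $z$, and this real integral
tends to $0$ by dominated convergence.
\<close>

lemma airy_laplace_small:
  assumes "\<epsilon> > 0"
  obtains A where "\<And>z. Re z \<ge> A \<Longrightarrow> cmod (airy_laplace z) < \<epsilon>"
proof -
  define \<phi> where "\<phi> = (\<lambda>a. \<integral>t. airy_weight t * exp (- a * (3 * t) powr (1 / 3)) \<partial>lborel)"
  have "(\<phi> \<longlongrightarrow> (\<integral>t. 0 \<partial>(lborel :: real measure))) at_top"
    unfolding \<phi>_def
  proof (rule integral_dominated_convergence_at_top)
    have "integrable lborel (\<lambda>t. norm (airy_laplace_kernel 0 t))"
      by (intro integrable_norm airy_laplace_kernel_integrable)
    then show "integrable lborel airy_weight"
      by (simp add: norm_airy_laplace_kernel)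
    show "AE t in lborel. ((\<lambda>a. airy_weight t * exp (- a * (3 * t) powr (1 / 3))) \<longlongrightarrow> 0) at_top"
    proof (rule AE_I2)
      fix t :: real
      show "((\<lambda>a. airy_weight t * exp (- a * (3 * t) powr (1 / 3))) \<longlongrightarrow> 0) at_top"
      proof (cases "t > 0")
        case True
        then have "(3 * t) powr (1 / 3) > 0" by simp
        then show ?thesis by real_asymp
      next
        case False
        then have "airy_weight t = 0"
          by (cases "t = 0") (auto simp: airy_weight_def)
        then show ?thesis by simp
      qed
    qed
    show "\<forall>\<^sub>F a in at_top. AE t in lborel. norm (airy_weight t * exp (- a * (3 * t) powr (1 / 3))) \<le> airy_weight t"
      using eventually_ge_at_top[of 0]
    proof eventually_elim
      case (elim a)
      show ?case
        using elim by (intro AE_I2) (auto simp: airy_weight_nonneg intro: mult_left_le)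
    qed
  qed measurable
  then have "\<forall>\<^sub>F a in at_top. \<phi> a < \<epsilon>"
    using assms by (intro order_tendstoD) auto
  then obtain A where A: "\<And>a. a \<ge> A \<Longrightarrow> \<phi> a < \<epsilon>"
    by (auto simp: eventually_at_top_linorder)
  have "cmod (airy_laplace z) \<le> \<phi> (Re z)" for z
    unfolding airy_laplace_def \<phi>_def norm_airy_laplace_kernel [symmetric]
    by (rule integral_norm_bound)
  then show ?thesis using A that by (meson order_le_less_trans)
qed

section \<open>The Airy function as a difference of Laplace integrals\<close>

text \<open>
The Maclaurin coefficients of the difference of Laplace integrals. The first factor has period
$3$ in $n$ and vanishes for $n \equiv 2$ modulo $3$.
\<close>

definition airy_coeff :: "nat \<Rightarrow> complex" where
  "airy_coeff n = (cis (pi / 3) * (- cis (pi / 3)) ^ n - cis (- pi / 3) * (- cis (- pi / 3)) ^ n)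
     * of_real (airy_moment n) / fact n / (\<i> * of_real (sqrt 3 * Gamma (1 / 3) * Gamma (2 / 3)))"

lemma fact_3_step: "fact (n + 3) = (of_nat (n + 3) * of_nat (n + 2) * (of_nat (n + 1) * fact n) :: complex)"
  by (simp add: numeral_3_eq_3)

lemma cis_third_cube: "(- cis (pi / 3)) ^ 3 = 1" "(- cis (- pi / 3)) ^ 3 = 1"
  by (simp_all add: power_minus_odd Complex.DeMoivre complex_eq_iff)

lemma airy_coeff_rec: "airy_coeff (n + 3) * (of_nat (n + 3) * of_nat (n + 2)) = airy_coeff n"
proof -
  have nz: "(of_nat (n + 1) :: complex) \<noteq> 0" "(of_nat (n + 2) :: complex) \<noteq> 0" "(of_nat (n + 3) :: complex) \<noteq> 0"
    by (simp_all only: of_nat_eq_0_iff)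
  have alg: "X * (p * M) / (r * q * (p * F)) / D * (r * q) = X * M / F / D"
    if "p \<noteq> 0" "q \<noteq> 0" "r \<noteq> 0" for p q r X M F D :: complex
    using that by simp
  show ?thesis
    unfolding airy_coeff_def airy_moment_rec fact_3_step power_add cis_third_cube mult_1_right
    by (simp only: of_real_mult of_real_of_nat_eq alg[OF nz])
qed

lemma airy_coeff_0_1_2:
  "airy_coeff 0 = of_real (3 powr (-2/3) / Gamma (2/3))"
  "airy_coeff 1 = - of_real (3 powr (-1/3) / Gamma (1/3))"
  "airy_coeff 2 = 0"
proof -
  have G: "Gamma (1/3 :: real) > 0" "Gamma (2/3 :: real) > 0"
    by (simp_all add: Gamma_real_pos)
  have d0: "cis (pi / 3) - cis (- pi / 3) = \<i> * of_real (sqrt 3)"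
    by (simp add: complex_eq_iff sin_60)
  have "cis (pi / 3) * (- cis (pi / 3)) - cis (- pi / 3) * (- cis (- pi / 3))
      = cis (- (pi / 3 + pi / 3)) - cis (pi / 3 + pi / 3)"
    by (simp add: cis_mult)
  also have "\<dots> = - (\<i> * of_real (sqrt 3))"
    using sin_120 by (simp add: complex_eq_iff)
  finally have d1: "cis (pi / 3) * (- cis (pi / 3)) - cis (- pi / 3) * (- cis (- pi / 3))
      = - (\<i> * of_real (sqrt 3))" .
  have m: "airy_moment 0 = 3 powr (-2/3) * Gamma (1/3)" "airy_moment 1 = 3 powr (-1/3) * Gamma (2/3)"
    by (simp_all add: airy_moment_def)
  have alg: "\<i> * of_real u * of_real (v * g) / 1 / (\<i> * of_real (u * g * h)) = (of_real (v / h) :: complex)"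
      "- (\<i> * of_real u) * of_real (v * h) / 1 / (\<i> * of_real (u * g * h)) = (- of_real (v / g) :: complex)"
    if "u > 0" "g > 0" "h > 0" for u v g h :: real
    using that by (simp_all add: field_simps)
  have d2: "cis (pi / 3) * (- cis (pi / 3)) ^ 2 - cis (- pi / 3) * (- cis (- pi / 3)) ^ 2 = 0"
  proof -
    have "x * (- x) ^ 2 = - ((- x) ^ 3)" for x :: complex
      by (simp add: power2_eq_square power3_eq_cube)
    then show ?thesis
      by (simp only: cis_third_cube) simp
  qed
  show "airy_coeff 0 = of_real (3 powr (-2/3) / Gamma (2/3))"
    unfolding airy_coeff_def m power_0 mult_1_right d0 fact_0 by (rule alg) (use G in auto)
  show "airy_coeff 1 = - of_real (3 powr (-1/3) / Gamma (1/3))"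
    unfolding airy_coeff_def m power_one_right d1 fact_1 by (rule alg) (use G in auto)
  show "airy_coeff 2 = 0"
    by (simp only: airy_coeff_def d2 mult_zero_left div_0)
qed

text \<open>
The coefficients are determined by the first three of them and the recursion, which the
coefficients on the right also satisfy. The first two agree with those of ${\rm Ai}$ because the ratio of the moments
$3^{-2/3}\Gamma(1/3)$ and $3^{-1/3}\Gamma(2/3)$ is that of ${\rm Ai}(0)$ and $-{\rm Ai}'(0)$.
\<close>

lemma airy_coeff_mod_3:
  "airy_coeff (3 * k) = of_real (3 powr (-2/3) / Gamma (2/3)) * (3 ^ k * pochhammer (1/3) k / fact (3 * k))"
  "airy_coeff (3 * k + 1) = - of_real (3 powr (-1/3) / Gamma (1/3)) * (3 ^ k * pochhammer (2/3) k / fact (3 * k + 1))"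
  "airy_coeff (3 * k + 2) = 0"
proof -
  have step: "airy_coeff (n + 3) = c * (3 ^ Suc k * pochhammer a (Suc k) / fact (n + 3))"
    if IH: "airy_coeff n = c * (3 ^ k * pochhammer a k / fact n)" and a: "3 * (a + of_nat k) = of_nat (n + 1)"
    for n k c a
  proof -
    have nz: "(of_nat (n + 1) :: complex) \<noteq> 0" "(of_nat (n + 2) :: complex) \<noteq> 0" "(of_nat (n + 3) :: complex) \<noteq> 0"
      by (simp_all only: of_nat_eq_0_iff)
    have "3 ^ Suc k * pochhammer a (Suc k) = of_nat (n + 1) * (3 ^ k * pochhammer a k)"
      unfolding a [symmetric] by (simp add: pochhammer_Suc algebra_simps)
    then have "c * (3 ^ Suc k * pochhammer a (Suc k) / fact (n + 3)) * (of_nat (n + 3) * of_nat (n + 2))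
        = airy_coeff n"
      unfolding IH fact_3_step using nz by (simp add: divide_simps del: of_nat_add)
    then show ?thesis
      using airy_coeff_rec[of n] nz by (metis mult_right_cancel no_zero_divisors)
  qed
  show "airy_coeff (3 * k) = of_real (3 powr (-2/3) / Gamma (2/3)) * (3 ^ k * pochhammer (1/3) k / fact (3 * k))"
  proof (induction k)
    case 0
    then show ?case by (simp add: airy_coeff_0_1_2)
  next
    case (Suc k)
    show ?case using step[OF Suc] by (simp add: algebra_simps)
  qed
  show "airy_coeff (3 * k + 1) = - of_real (3 powr (-1/3) / Gamma (1/3)) * (3 ^ k * pochhammer (2/3) k / fact (3 * k + 1))"
  proof (induction k)
    case 0
    then show ?case using airy_coeff_0_1_2(2) by simp
  next
    case (Suc k)
    show ?case using step[OF Suc] by (simp add: algebra_simps)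
  qed
  show "airy_coeff (3 * k + 2) = 0"
  proof (induction k)
    case 0
    then show ?case using airy_coeff_0_1_2(3) by (simp add: numeral_2_eq_2)
  next
    case (Suc k)
    have "(of_nat (3 * k + 2 + 3) * of_nat (3 * k + 2 + 2) :: complex) \<noteq> 0"
      by (simp only: of_nat_mult [symmetric] of_nat_eq_0_iff) simp
    then have "airy_coeff (3 * k + 2 + 3) = 0"
      using airy_coeff_rec[of "3 * k + 2"] Suc by (metis mult_eq_0_iff)
    then show ?case by (simp add: algebra_simps)
  qed
qed

lemma airy_coeff_sums_laplace:
  "(\<lambda>n. airy_coeff n * z ^ n) sums
    ((cis (pi / 3) * airy_laplace (cis (pi / 3) * z) - cis (- pi / 3) * airy_laplace (cis (- pi / 3) * z))
      / (\<i> * of_real (sqrt 3 * Gamma (1 / 3) * Gamma (2 / 3))))"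
proof -
  let ?D = "\<i> * of_real (sqrt 3 * Gamma (1 / 3) * Gamma (2 / 3)) :: complex"
  have "(\<lambda>n. (cis (pi / 3) * (of_real (airy_moment n) / fact n * (- (cis (pi / 3) * z)) ^ n)
      - cis (- pi / 3) * (of_real (airy_moment n) / fact n * (- (cis (- pi / 3) * z)) ^ n)) / ?D) sums
    ((cis (pi / 3) * airy_laplace (cis (pi / 3) * z) - cis (- pi / 3) * airy_laplace (cis (- pi / 3) * z)) / ?D)"
    by (intro sums_divide sums_diff sums_mult airy_laplace_sums)
  moreover have "(a * (m / f * (- (a * z)) ^ n) - b * (m / f * (- (b * z)) ^ n)) / D
      = (a * (- a) ^ n - b * (- b) ^ n) * m / f / D * z ^ n" for a b m f D :: complex and n
    unfolding mult_minus_left [symmetric] power_mult_distrib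
    by (simp add: divide_inverse algebra_simps)
  ultimately show ?thesis
    unfolding airy_coeff_def by simp
qed

lemma airy_coeff_abs_summable: "summable (\<lambda>n. cmod (airy_coeff n * z ^ n))"
proof (rule summable_comparison_test')
  define D where "D = \<i> * complex_of_real (sqrt 3 * Gamma (1 / 3) * Gamma (2 / 3))"
  show "summable (\<lambda>n. 2 / cmod D * (airy_moment n / fact n * cmod z ^ n))"
    by (intro summable_mult airy_moment_powser_summable) simp
  fix n :: nat assume "n \<ge> 0"
  define X where "X = cis (pi / 3) * (- cis (pi / 3)) ^ n - cis (- pi / 3) * (- cis (- pi / 3)) ^ n"
  have "cmod X \<le> 1 + 1"
    unfolding X_def by (rule order_trans[OF norm_triangle_ineq4]) (simp add: norm_mult norm_power)
  then have "cmod X * (airy_moment n / fact n / cmod D * cmod z ^ n)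
      \<le> 2 * (airy_moment n / fact n / cmod D * cmod z ^ n)"
    using airy_moment_pos[of n] by (intro mult_right_mono) auto
  moreover have "airy_coeff n = X * of_real (airy_moment n) / fact n / D"
    by (simp only: airy_coeff_def X_def D_def)
  ultimately show "norm (cmod (airy_coeff n * z ^ n)) \<le> 2 / cmod D * (airy_moment n / fact n * cmod z ^ n)"
    using airy_moment_pos[of n] by (simp add: norm_mult norm_divide norm_power mult_ac)
qed

text \<open>
Grouping the terms of an absolutely convergent series in blocks of three separates the two series that define
${\rm Ai}$.
\<close>

lemma airy_Ai_sums: "(\<lambda>n. airy_coeff n * z ^ n) sums airy_Ai z"
proof -
  let ?a = "\<lambda>n. airy_coeff n * z ^ n"
  have "(\<lambda>k. \<Sum>n = k * 3..<k * 3 + 3. cmod (?a n)) sums (\<Sum>n. cmod (?a n))"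
    by (rule sums_group) (use summable_sums[OF airy_coeff_abs_summable] in auto)
  then have S: "summable (\<lambda>k. cmod (?a (3 * k)) + cmod (?a (3 * k + 1)) + cmod (?a (3 * k + 2)))"
    by (simp add: sums_iff numeral_3_eq_3 mult.commute)
  have S0: "summable (\<lambda>k. ?a (3 * k))"
    by (rule summable_comparison_test'[OF S]) simp
  have S1: "summable (\<lambda>k. ?a (3 * k + 1))"
    by (rule summable_comparison_test'[OF S]) simp
  define c0 c1 :: complex where "c0 = of_real (3 powr (-2/3) / Gamma (2/3))" and "c1 = of_real (3 powr (-1/3) / Gamma (1/3))"
  have c: "c0 \<noteq> 0" "c1 \<noteq> 0"
    by (auto simp: c0_def c1_def Gamma_eq_zero_iff dest: nonpos_Ints_nonpos)
  define f g where "f = (\<lambda>k. 3 ^ k * pochhammer (1/3) k * z ^ (3 * k) / fact (3 * k))"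
    and "g = (\<lambda>k. 3 ^ k * pochhammer (2/3) k * z ^ (3 * k + 1) / fact (3 * k + 1))"
  have a0: "?a (3 * k) = c0 * f k" and a1: "?a (3 * k + 1) = - c1 * g k" for k
    unfolding airy_coeff_mod_3 c0_def c1_def f_def g_def by simp_all
  have sf: "summable f"
    using S0 c unfolding a0 by (simp add: summable_cmult_iff)
  have sg: "summable g"
    using summable_minus[OF S1] c unfolding a1 by (simp add: summable_cmult_iff)
  have "(\<lambda>k. c0 * f k - c1 * g k) sums (c0 * suminf f - c1 * suminf g)"
    by (intro sums_diff sums_mult summable_sums sf sg)
  also have "c0 * suminf f - c1 * suminf g = airy_Ai z"
    by (simp only: airy_Ai_def c0_def c1_def f_def g_def)
  finally have 1: "(\<lambda>k. c0 * f k - c1 * g k) sums airy_Ai z" .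
  have "(\<lambda>k. \<Sum>n = k * 3..<k * 3 + 3. ?a n) sums suminf ?a"
    by (rule sums_group) (use summable_sums[OF summable_norm_cancel[OF airy_coeff_abs_summable]] in auto)
  moreover have "(\<Sum>n = k * 3..<k * 3 + 3. ?a n) = c0 * f k - c1 * g k" for k
  proof -
    have "(\<Sum>n = k * 3..<k * 3 + 3. ?a n) = ?a (3 * k) + ?a (3 * k + 1) + ?a (3 * k + 2)"
      by (simp add: numeral_3_eq_3 mult.commute)
    then show ?thesis unfolding a0 a1 airy_coeff_mod_3(3) by simp
  qed
  ultimately have "(\<lambda>k. c0 * f k - c1 * g k) sums suminf ?a" by simp
  then have "suminf ?a = airy_Ai z"
    using 1 sums_unique2 by blast
  then show ?thesis
    using summable_sums[OF summable_norm_cancel[OF airy_coeff_abs_summable]] by metis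
qed

lemma airy_Ai_laplace:
  "airy_Ai z = (cis (pi / 3) * airy_laplace (cis (pi / 3) * z) - cis (- pi / 3) * airy_laplace (cis (- pi / 3) * z))
      / (\<i> * of_real (sqrt 3 * Gamma (1 / 3) * Gamma (2 / 3)))"
  using airy_Ai_sums airy_coeff_sums_laplace sums_unique2 by blast

lemma airy_Ai_solution: "airy_solution airy_Ai"
  and airy_Ai_0: "airy_Ai 0 = airy_coeff 0"
  and airy_Ai_deriv_0: "deriv airy_Ai 0 = airy_coeff 1"
proof -
  define A where "A = Abs_fps airy_coeff"
  have "fps_conv_radius A = \<infinity>"
    unfolding fps_conv_radius_def A_def fps_nth_Abs_fps
    by (rule conv_radius_inftyI'') (rule summable_norm_cancel[OF airy_coeff_abs_summable])
  then have R: "ereal (norm z) < fps_conv_radius A" "ereal (norm z) < fps_conv_radius (fps_deriv A)" for z :: complex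
    using fps_conv_radius_deriv[of A] by auto
  have A: "airy_Ai = eval_fps A"
    using airy_Ai_sums by (auto simp: eval_fps_def A_def sums_iff)
  have "fps_deriv (fps_deriv A) = fps_X * A"
  proof (rule fps_ext)
    fix n
    show "fps_nth (fps_deriv (fps_deriv A)) n = fps_nth (fps_X * A) n"
    proof (cases n)
      case 0
      then show ?thesis using airy_coeff_0_1_2(3) by (simp add: A_def numeral_2_eq_2)
    next
      case (Suc m)
      then show ?thesis
        using airy_coeff_rec[of m] by (simp add: A_def numeral_3_eq_3 numeral_2_eq_2 algebra_simps)
    qed
  qed
  then have ode: "eval_fps (fps_deriv (fps_deriv A)) z = z * eval_fps A z" for z
    using R[of z] by (simp add: eval_fps_mult)
  have D1: "(airy_Ai has_field_derivative eval_fps (fps_deriv A) z) (at z)" for z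
    unfolding A by (rule has_field_derivative_eval_fps) (rule R)
  have D2: "(eval_fps (fps_deriv A) has_field_derivative z * airy_Ai z) (at z)" for z
    unfolding A ode [symmetric] by (rule has_field_derivative_eval_fps) (rule R)
  show "airy_solution airy_Ai"
    by (rule airy_solutionI(1)[OF D1 D2])
  show "airy_Ai 0 = airy_coeff 0"
    by (simp add: A eval_fps_at_0) (simp add: A_def)
  show "deriv airy_Ai 0 = airy_coeff 1"
    unfolding airy_solutionI(2)[OF D1 D2] by (simp add: eval_fps_at_0) (simp add: A_def)
qed

lemma airy_coeff_nonzero: "airy_coeff 0 \<noteq> 0" "airy_coeff 1 \<noteq> 0"
  by (auto simp: airy_coeff_0_1_2 Gamma_eq_zero_iff dest: nonpos_Ints_nonpos simp del: One_nat_def)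

section \<open>The zeros of Ai are negative\<close>

lemma airy_Ai_small:
  assumes "\<epsilon> > 0"
  obtains A where "\<And>z. Re (cis (pi / 3) * z) \<ge> A \<Longrightarrow> Re (cis (- pi / 3) * z) \<ge> A \<Longrightarrow> cmod (airy_Ai z) < \<epsilon>"
proof -
  define D where "D = \<i> * complex_of_real (sqrt 3 * Gamma (1 / 3) * Gamma (2 / 3))"
  have "D \<noteq> 0"
    by (auto simp: D_def Gamma_eq_zero_iff dest: nonpos_Ints_nonpos)
  then have "\<epsilon> * cmod D / 2 > 0" using assms by simp
  then obtain A where A: "\<And>z. Re z \<ge> A \<Longrightarrow> cmod (airy_laplace z) < \<epsilon> * cmod D / 2"
    using airy_laplace_small by blast
  show ?thesis
  proof (rule that)
    fix z assume z: "Re (cis (pi / 3) * z) \<ge> A" "Re (cis (- pi / 3) * z) \<ge> A"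
    have "cmod (airy_Ai z) * cmod D
        = cmod (cis (pi / 3) * airy_laplace (cis (pi / 3) * z) - cis (- pi / 3) * airy_laplace (cis (- pi / 3) * z))"
      unfolding airy_Ai_laplace[of z] D_def [symmetric] using \<open>D \<noteq> 0\<close> by (simp add: norm_divide)
    also have "\<dots> \<le> cmod (cis (pi / 3) * airy_laplace (cis (pi / 3) * z)) + cmod (cis (- pi / 3) * airy_laplace (cis (- pi / 3) * z))"
      by (rule norm_triangle_ineq4)
    also have "\<dots> < \<epsilon> * cmod D / 2 + \<epsilon> * cmod D / 2"
      unfolding norm_mult norm_cis mult_1_left using A[OF z(1)] A[OF z(2)] by (rule add_strict_mono)
    finally show "cmod (airy_Ai z) < \<epsilon>"
      using \<open>D \<noteq> 0\<close> by simp
  qed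
qed

text \<open>
Along a horizontal line the real parts of $e^{\pm i\pi/3} z$ tend to infinity, uniformly on discs of
radius $1$. Cauchy's inequality on these discs transfers the decay to the derivative.
\<close>

lemma airy_Ai_horizontal_decay:
  "((\<lambda>t. airy_Ai (z + of_real t)) \<longlongrightarrow> 0) at_top"
  "((\<lambda>t. deriv airy_Ai (z + of_real t)) \<longlongrightarrow> 0) at_top"
proof -
  have small: "\<forall>\<^sub>F t in at_top. \<forall>\<zeta>. cmod (\<zeta> - (z + of_real t)) \<le> 1 \<longrightarrow> cmod (airy_Ai \<zeta>) < \<epsilon>"
    if \<epsilon>: "\<epsilon> > 0" for \<epsilon>
  proof -
    obtain A where A: "\<And>z. Re (cis (pi / 3) * z) \<ge> A \<Longrightarrow> Re (cis (- pi / 3) * z) \<ge> A \<Longrightarrow> cmod (airy_Ai z) < \<epsilon>"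
      using airy_Ai_small[OF \<epsilon>] by blast
    have Re_ge: "Re (c * \<zeta>) \<ge> A"
      if c: "cmod c = 1" "Re c = 1 / 2" and t: "t \<ge> 2 * (A + 1 + cmod z)" and \<zeta>: "cmod (\<zeta> - (z + of_real t)) \<le> 1"
      for c \<zeta> t
    proof -
      have "c * \<zeta> = of_real t * c + c * z + c * (\<zeta> - (z + of_real t))"
        by (simp add: algebra_simps)
      then have "Re (c * \<zeta>) = t * Re c + Re (c * z) + Re (c * (\<zeta> - (z + of_real t)))"
        by simp
      moreover define \<tau> where "\<tau> = t / 2"
      moreover have "t * Re c = \<tau>"
        using c(2) by (simp add: \<tau>_def)
      ultimately have "Re (c * \<zeta>) = \<tau> + Re (c * z) + Re (c * (\<zeta> - (z + of_real t)))"
        by (simp only:)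
      moreover have "A + 1 + cmod z \<le> \<tau>"
        using t by (simp add: \<tau>_def)
      moreover have "\<bar>Re (c * z)\<bar> \<le> cmod z"
        using abs_Re_le_cmod[of "c * z"] c(1) by (simp add: norm_mult)
      moreover have "\<bar>Re (c * (\<zeta> - (z + of_real t)))\<bar> \<le> 1"
        using abs_Re_le_cmod[of "c * (\<zeta> - (z + of_real t))"] c(1) \<zeta> by (simp add: norm_mult)
      ultimately show ?thesis by linarith
    qed
    show ?thesis
      using eventually_ge_at_top[of "2 * (A + 1 + cmod z)"]
    proof eventually_elim
      case (elim t)
      show ?case
        by (intro allI impI A Re_ge[OF _ _ elim]) (auto simp: cos_60)
    qed
  qed
  show "((\<lambda>t. airy_Ai (z + of_real t)) \<longlongrightarrow> 0) at_top"
    unfolding tendsto_iff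
  proof (intro allI impI)
    fix \<epsilon> :: real assume "\<epsilon> > 0"
    from small[OF this] show "\<forall>\<^sub>F t in at_top. dist (airy_Ai (z + of_real t)) 0 < \<epsilon>"
      by eventually_elim simp
  qed
  show "((\<lambda>t. deriv airy_Ai (z + of_real t)) \<longlongrightarrow> 0) at_top"
    unfolding tendsto_iff
  proof (intro allI impI)
    fix \<epsilon> :: real assume "\<epsilon> > 0"
    then have "\<epsilon> / 2 > 0" by simp
    from small[OF this] show "\<forall>\<^sub>F t in at_top. dist (deriv airy_Ai (z + of_real t)) 0 < \<epsilon>"
    proof eventually_elim
      case (elim t)
      have hol: "airy_Ai holomorphic_on S" for S
        using airy_Ai_solution holomorphic_on_subset by (auto simp: airy_solution_def)
      have "norm ((deriv ^^ 1) airy_Ai (z + of_real t)) \<le> fact 1 * (\<epsilon> / 2) / 1 ^ 1"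
        by (rule Cauchy_inequality[OF hol holomorphic_on_imp_continuous_on[OF hol]])
          (use elim in \<open>auto simp: norm_minus_commute intro!: less_imp_le\<close>)
      then show ?case using \<open>\<epsilon> > 0\<close> by simp
    qed
  qed
qed

lemma nondecreasing_and_vanishing:
  fixes \<phi> :: "real \<Rightarrow> real"
  assumes D: "\<And>t. (\<phi> has_real_derivative \<phi>' t) (at t)" and "\<And>t. t \<ge> 0 \<Longrightarrow> \<phi>' t \<ge> 0"
    and "\<phi> 0 = 0" "(\<phi> \<longlongrightarrow> 0) at_top" and "t > 0"
  shows "\<phi>' t = 0"
proof -
  have mono: "\<phi> a \<le> \<phi> b" if "0 \<le> a" "a \<le> b" for a b
    using that assms(2) D by (intro DERIV_nonneg_imp_nondecreasing[of a b \<phi>]) fastforce+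
  have zero: "\<phi> s = 0" if "s \<ge> 0" for s
  proof (rule antisym)
    have "\<forall>\<^sub>F b in at_top. \<phi> s \<le> \<phi> b"
      using eventually_ge_at_top[of s] by eventually_elim (use that in \<open>simp add: mono\<close>)
    with assms(4) show "\<phi> s \<le> 0"
      by (intro tendsto_lowerbound) auto
    show "0 \<le> \<phi> s" using mono[of 0 s] that assms(3) by simp
  qed
  have "\<forall>\<^sub>F s in nhds t. \<phi> s = 0"
    using eventually_nhds_in_open[of "{0<..}" t] \<open>t > 0\<close> by (auto elim!: eventually_mono simp: zero)
  then have "(\<phi> has_real_derivative 0) (at t)"
    by (subst DERIV_cong_ev[OF refl _ refl]) auto
  then show ?thesis using D DERIV_unique by blast
qed

text \<open>
For $J = f' \bar f$ with $f(t) = {\rm Ai}(z + t)$ we have $J' = |f'|^2 + (z + t)|f|^2$. If $z$ is not real, $J$ is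
considered through ${\rm Im}\, z \cdot {\rm Im}\, J$, which has derivative $({\rm Im}\, z)^2 |f|^2$; if $z$ is real and
nonnegative, through its real part. In both cases a monotone function vanishes at $0$ and at infinity, hence $f = 0$ on a half-line, which contradicts
${\rm Ai}(0) \neq 0$.
\<close>

lemma airy_Ai_zeros:
  assumes zero: "airy_Ai z = 0"
  shows "z \<in> ray pi"
proof (rule ccontr)
  assume not_ray: "z \<notin> ray pi"
  have pos: "Re z \<ge> 0" if "Im z = 0"
  proof (rule ccontr)
    assume "\<not> Re z \<ge> 0"
    then have "z = of_real (- Re z) * cis pi" "- Re z > 0"
      using that by (auto simp: complex_eq_iff)
    then show False using not_ray unfolding ray_def by blast
  qed
  define f f' where "f = (\<lambda>t::real. airy_Ai (z + of_real t))" and "f' = (\<lambda>t::real. deriv airy_Ai (z + of_real t))"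
  have shift: "((\<lambda>\<zeta>. z + \<zeta>) has_field_derivative 1) (at \<zeta>)" for \<zeta> :: complex
    by (auto intro!: derivative_eq_intros)
  have Df: "(f has_vector_derivative f' t) (at t)" for t
    unfolding f_def f'_def
    by (rule has_vector_derivative_real_field)
      (use DERIV_chain2[OF airy_solution_DERIV(1)[OF airy_Ai_solution] shift] in simp)
  have Df': "(f' has_vector_derivative (z + of_real t) * f t) (at t)" for t
    unfolding f_def f'_def
    by (rule has_vector_derivative_real_field)
      (use DERIV_chain2[OF airy_solution_DERIV(2)[OF airy_Ai_solution] shift] in simp)
  define J where "J = (\<lambda>t. f' t * cnj (f t))"
  have DJ: "(J has_vector_derivative of_real ((cmod (f' t))\<^sup>2) + (z + of_real t) * of_real ((cmod (f t))\<^sup>2)) (at t)" for t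
  proof -
    have "(J has_vector_derivative f' t * cnj (f' t) + (z + of_real t) * f t * cnj (f t)) (at t)"
      unfolding J_def by (intro has_vector_derivative_mult has_vector_derivative_cnj Df Df')
    then show ?thesis by (simp only: complex_norm_square mult.assoc)
  qed
  have J0: "J 0 = 0" using zero by (simp add: J_def f_def)
  have J_lim: "(J \<longlongrightarrow> 0) at_top"
    using tendsto_mult[OF airy_Ai_horizontal_decay(2)[of z] tendsto_cnj[OF airy_Ai_horizontal_decay(1)[of z]]]
    by (simp add: J_def f_def f'_def)
  have f_zero: "f t = 0" if t: "t > 0" for t
  proof (cases "Im z = 0")
    case True
    have "((\<lambda>t. Re (J t)) has_real_derivative (cmod (f' t))\<^sup>2 + (Re z + t) * (cmod (f t))\<^sup>2) (at t)" for t
      using bounded_linear.has_vector_derivative[OF bounded_linear_Re DJ[of t]]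
      by (simp add: has_real_derivative_iff_has_vector_derivative)
    from nondecreasing_and_vanishing[OF this _ _ _ t]
    have "(cmod (f' t))\<^sup>2 + (Re z + t) * (cmod (f t))\<^sup>2 = 0"
      using tendsto_Re[OF J_lim] pos[OF True] by (simp add: J0)
    moreover have "(Re z + t) * (cmod (f t))\<^sup>2 \<ge> 0" using pos[OF True] t by simp
    ultimately have "(Re z + t) * (cmod (f t))\<^sup>2 = 0"
      by (smt (verit) zero_le_power2)
    then show ?thesis using pos[OF True] t by simp
  next
    case False
    have "((\<lambda>t. Im z * Im (J t)) has_real_derivative Im z * (Im z * (cmod (f t))\<^sup>2)) (at t)" for t
      using DERIV_cmult[OF bounded_linear.has_vector_derivative[OF bounded_linear_Im DJ[of t],
          folded has_real_derivative_iff_has_vector_derivative]]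
      by simp
    from nondecreasing_and_vanishing[OF this _ _ _ t]
    have "Im z * (Im z * (cmod (f t))\<^sup>2) = 0"
      using tendsto_mult_right_zero[OF tendsto_Im[OF J_lim, simplified], of "Im z"]
      by (simp add: J0 flip: mult.assoc)
    then show ?thesis using False by simp
  qed
  have "airy_Ai 0 = 0"
  proof (rule analytic_continuation[of airy_Ai UNIV "(\<lambda>t. z + of_real t) ` {0<..}" z])
    show "airy_Ai holomorphic_on UNIV"
      using airy_Ai_solution by (simp add: airy_solution_def)
    show "z islimpt (\<lambda>t. z + of_real t) ` {0<..}"
      unfolding islimpt_approachable
    proof (intro allI impI)
      fix e :: real assume "e > 0"
      then have "z + of_real (e / 2) \<in> (\<lambda>t. z + of_real t) ` {0<..}"
        by (intro imageI) simp
      moreover have "z + of_real (e / 2) \<noteq> z" "dist (z + of_real (e / 2)) z < e"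
        using \<open>e > 0\<close> by (simp_all add: dist_norm norm_divide)
      ultimately show "\<exists>x'\<in>(\<lambda>t. z + of_real t) ` {0<..}. x' \<noteq> z \<and> dist x' z < e"
        by blast
    qed
    show "\<And>w. w \<in> (\<lambda>t. z + of_real t) ` {0<..} \<Longrightarrow> airy_Ai w = 0"
      using f_zero by (auto simp: f_def)
  qed auto
  then show False
    using airy_coeff_nonzero(1) by (simp add: airy_Ai_0)
qed

section \<open>Transport between the three rays\<close>

lemma cube_root_facts:
  "cis (2 * pi / 3) ^ 3 = 1" "cis (- 2 * pi / 3) ^ 3 = 1"
  "cis (2 * pi / 3) * cis (- 2 * pi / 3) = 1" "cis (- 2 * pi / 3) * cis (2 * pi / 3) = 1"
  "cis (2 * pi / 3) * cis (2 * pi / 3) = cis (- 2 * pi / 3)"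
  "cis (- 2 * pi / 3) * cis (- 2 * pi / 3) = cis (2 * pi / 3)"
  "cis (2 * pi / 3) \<noteq> 1" "cis (- 2 * pi / 3) \<noteq> 1" "cis (2 * pi / 3) \<noteq> cis (- 2 * pi / 3)"
proof -
  have [simp]: "cis (- (2 * pi)) = 1"
    by (simp add: complex_eq_iff)
  show "cis (2 * pi / 3) ^ 3 = 1" "cis (- 2 * pi / 3) ^ 3 = 1"
    "cis (2 * pi / 3) * cis (- 2 * pi / 3) = 1" "cis (- 2 * pi / 3) * cis (2 * pi / 3) = 1"
    by (simp_all add: Complex.DeMoivre cis_mult)
  then show "cis (2 * pi / 3) * cis (2 * pi / 3) = cis (- 2 * pi / 3)"
    "cis (- 2 * pi / 3) * cis (- 2 * pi / 3) = cis (2 * pi / 3)"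
    unfolding power3_eq_cube by (metis mult.assoc mult.right_neutral mult.left_neutral)+
  show "cis (2 * pi / 3) \<noteq> 1" "cis (- 2 * pi / 3) \<noteq> 1" "cis (2 * pi / 3) \<noteq> cis (- 2 * pi / 3)"
    using cos_120 sin_120 by (auto simp: complex_eq_iff)
qed

lemma ray_rotate: "z * cis \<alpha> \<in> ray \<phi> \<longleftrightarrow> z \<in> ray (\<phi> - \<alpha>)"
proof -
  have "z * cis \<alpha> = of_real r * cis \<phi> \<longleftrightarrow> z = of_real r * cis (\<phi> - \<alpha>)" for r
    by (simp add: cis_divide [symmetric] field_simps)
  then show ?thesis by (simp add: ray_def)
qed

lemma zeros_tend_to_ray_rotate:
  assumes "zeros_tend_to_ray w \<phi>"
  shows "zeros_tend_to_ray (\<lambda>z. w (z * cis \<alpha>)) (\<phi> - \<alpha>)"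
proof -
  obtain zs where zs: "\<And>n. w (zs n) = 0" "filterlim (\<lambda>n. norm (zs n)) at_top sequentially"
      "(\<lambda>n. infdist (zs n) (ray \<phi>)) \<longlonglongrightarrow> 0"
    using assms by (auto simp: zeros_tend_to_ray_def)
  have "ray (\<phi> - \<alpha>) = (\<lambda>z. z * cis (- \<alpha>)) ` ray \<phi>"
  proof -
    have inv: "z * cis \<alpha> * cis (- \<alpha>) = z" "z * cis (- \<alpha>) * cis \<alpha> = z" for z
      by (simp_all add: mult.assoc cis_mult)
    show ?thesis
    proof (intro equalityI subsetI)
      fix z assume "z \<in> ray (\<phi> - \<alpha>)"
      then have "z * cis \<alpha> \<in> ray \<phi>" by (simp only: ray_rotate)
      then show "z \<in> (\<lambda>z. z * cis (- \<alpha>)) ` ray \<phi>"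
        by (rule image_eqI[rotated]) (simp only: inv)
    next
      fix z assume "z \<in> (\<lambda>z. z * cis (- \<alpha>)) ` ray \<phi>"
      then show "z \<in> ray (\<phi> - \<alpha>)"
        by (auto simp only: ray_rotate [symmetric] inv)
    qed
  qed
  moreover have "dist (z * cis (- \<alpha>)) (y * cis (- \<alpha>)) = dist z y" for z y
    by (simp add: dist_norm norm_mult flip: left_diff_distrib)
  ultimately have "infdist (z * cis (- \<alpha>)) (ray (\<phi> - \<alpha>)) = infdist z (ray \<phi>)" for z
    by (simp add: infdist_def image_image)
  then show ?thesis
    unfolding zeros_tend_to_ray_def using zs
    by (intro exI[of _ "\<lambda>n. zs n * cis (- \<alpha>)"]) (simp add: mult.assoc cis_mult norm_mult)
qed

text \<open>
The hypothesis says that the zeros lie on the rays $\arg z = \pm\pi/3$ or at the origin. Such a point is at distance at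
least $|z|/2$ from the left half-plane.
\<close>

lemma zeros_not_near_negative_axis:
  assumes "\<And>z. w z = 0 \<Longrightarrow> Re z = norm z / 2"
  shows "\<not> zeros_tend_to_ray w (- pi)"
proof
  assume "zeros_tend_to_ray w (- pi)"
  then obtain zs where zs: "\<And>n. w (zs n) = 0" "filterlim (\<lambda>n. norm (zs n)) at_top sequentially"
      "(\<lambda>n. infdist (zs n) (ray (- pi))) \<longlonglongrightarrow> 0"
    by (auto simp: zeros_tend_to_ray_def)
  have "ray (- pi) \<noteq> {}"
    unfolding ray_neg by (auto intro: exI[of _ 1])
  have far: "norm (zs n) / 2 \<le> infdist (zs n) (ray (- pi))" for n
    unfolding infdist_notempty[OF \<open>ray (- pi) \<noteq> {}\<close>]
  proof (rule cINF_greatest[OF \<open>ray (- pi) \<noteq> {}\<close>])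
    fix a assume "a \<in> ray (- pi)"
    then have "Re (zs n) \<le> Re (zs n - a)" by (auto simp: ray_neg)
    also have "\<dots> \<le> dist (zs n) a" unfolding dist_norm by (rule complex_Re_le_cmod)
    finally show "norm (zs n) / 2 \<le> dist (zs n) a" using assms[OF zs(1)[of n]] by simp
  qed
  have "\<forall>\<^sub>F n in sequentially. infdist (zs n) (ray (- pi)) < 1"
    using zs(3) by (rule order_tendstoD) simp
  moreover have "\<forall>\<^sub>F n in sequentially. 2 \<le> norm (zs n)"
    using zs(2) by (simp add: filterlim_at_top)
  ultimately have "\<forall>\<^sub>F n in sequentially. False"
  proof eventually_elim
    case (elim n)
    then show ?case using far[of n] by simp
  qed
  then show False by simp
qed

lemma ray_pi: "ray pi = ray (- pi)"
  by (simp add: ray_def complex_eq_iff)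

lemma airy_Ai_rotated_zeros:
  "airy_Ai (z * cis (2 * pi / 3)) = 0 \<Longrightarrow> z \<in> ray (pi / 3)"
  "airy_Ai (z * cis (- 2 * pi / 3)) = 0 \<Longrightarrow> z \<in> ray (- pi / 3)"
proof -
  have angles: "pi - 2 * pi / 3 = pi / 3" "- pi - (- 2 * pi / 3) = - pi / 3"
    by simp_all
  show "airy_Ai (z * cis (2 * pi / 3)) = 0 \<Longrightarrow> z \<in> ray (pi / 3)"
    by (drule airy_Ai_zeros) (simp only: ray_rotate angles)
  show "airy_Ai (z * cis (- 2 * pi / 3)) = 0 \<Longrightarrow> z \<in> ray (- pi / 3)"
    by (drule airy_Ai_zeros) (simp only: ray_pi ray_rotate angles)
qed

text \<open>
The functions ${\rm Ai}(\omega z)$ and ${\rm Ai}(\omega^2 z)$ have no zeros near the negative axis, so each of them lacks one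
of the two waves, and by their independence not the same one. A solution lacking a wave is therefore a multiple
of the one of them that lacks it too.
\<close>

lemma zeros_near_negative_axis_unless_multiple:
  assumes w: "airy_solution w"
    and "\<nexists>c. \<forall>z. w z = c * airy_Ai (z * cis (2 * pi / 3))"
    and "\<nexists>c. \<forall>z. w z = c * airy_Ai (z * cis (- 2 * pi / 3))"
  shows "zeros_tend_to_ray w (- pi)"
proof -
  define f g where "f = (\<lambda>z. airy_Ai (z * cis (2 * pi / 3)))" and "g = (\<lambda>z. airy_Ai (z * cis (- 2 * pi / 3)))"
  have f: "airy_solution f" and g: "airy_solution g"
    unfolding f_def g_def by (intro airy_solution_rotate(1)[OF airy_Ai_solution] cube_root_facts)+
  have "wronskian f g 0 = airy_coeff 0 * airy_coeff 1 * (cis (- 2 * pi / 3) - cis (2 * pi / 3))"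
    unfolding wronskian_def f_def g_def airy_solution_rotate(2)[OF airy_Ai_solution cube_root_facts(1)]
      airy_solution_rotate(2)[OF airy_Ai_solution cube_root_facts(2)]
    by (simp add: airy_Ai_0 airy_Ai_deriv_0 algebra_simps)
  then have W: "wronskian f g 0 \<noteq> 0"
    using airy_coeff_nonzero cube_root_facts(9) by simp
  moreover have "wronskian g f 0 = - wronskian f g 0"
    by (simp add: wronskian_def)
  ultimately have W': "wronskian g f 0 \<noteq> 0"
    by simp
  have Re_ray: "Re z = norm z / 2" if "z \<in> ray (pi / 3) \<or> z \<in> ray (- pi / 3)" for z
    using that by (auto simp: ray_def norm_mult cos_60)
  have f_lg: "lg_vanishes \<i> f \<or> lg_vanishes (- \<i>) f"
  proof (rule ccontr)
    assume "\<not> ?thesis"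
    moreover have "Re z = norm z / 2" if "f z = 0" for z
      using airy_Ai_rotated_zeros(1) that Re_ray unfolding f_def by blast
    ultimately show False
      using zeros_near_negative_axis[OF f] zeros_not_near_negative_axis[of f] by blast
  qed
  have g_lg: "lg_vanishes \<i> g \<or> lg_vanishes (- \<i>) g"
  proof (rule ccontr)
    assume "\<not> ?thesis"
    moreover have "Re z = norm z / 2" if "g z = 0" for z
      using airy_Ai_rotated_zeros(2) that Re_ray unfolding g_def by blast
    ultimately show False
      using zeros_near_negative_axis[OF g] zeros_not_near_negative_axis[of g] by blast
  qed
  have not_both: "\<not> (lg_vanishes s f \<and> lg_vanishes s g)" if "s \<in> {\<i>, - \<i>}" for s
    using wronskian_zero_if_lg_vanishes[OF f g that] W by blast
  have "\<not> lg_vanishes s w" if s: "s \<in> {\<i>, - \<i>}" for s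
  proof
    assume ws: "lg_vanishes s w"
    have "lg_vanishes s f \<or> lg_vanishes s g"
      using f_lg g_lg not_both[of \<i>] not_both[of "- \<i>"] s by auto
    then show False
    proof
      assume "lg_vanishes s f"
      then have "\<exists>c. \<forall>z. w z = c * f z"
        using multiple_if_wronskian_zero[OF w f g _ W] wronskian_zero_if_lg_vanishes[OF w f s ws] by blast
      then show False using assms(2) by (simp add: f_def)
    next
      assume "lg_vanishes s g"
      then have "\<exists>c. \<forall>z. w z = c * g z"
        using multiple_if_wronskian_zero[OF w g f _ W'] wronskian_zero_if_lg_vanishes[OF w g s ws] by blast
      then show False using assms(3) by (simp add: g_def)
    qed
  qed
  then show ?thesis
    by (intro zeros_near_negative_axis[OF w]) auto
qed

text \<open>
Comparison at $0$ of the values gives the factor $1$, and then comparison of the derivatives gives $c = 1$.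
\<close>

lemma airy_Ai_not_multiple_of_rotation:
  assumes "c ^ 3 = 1" "c \<noteq> 1"
  shows "\<nexists>k. \<forall>z. airy_Ai z = k * airy_Ai (z * c)"
proof
  assume "\<exists>k. \<forall>z. airy_Ai z = k * airy_Ai (z * c)"
  then obtain k where k: "airy_Ai z = k * airy_Ai (z * c)" for z by blast
  have "k = 1"
    using k[of 0] airy_coeff_nonzero(1) by (simp add: airy_Ai_0)
  then have "(\<lambda>z. airy_Ai (z * c)) = airy_Ai"
    using k by (auto simp del: One_nat_def)
  then have "deriv airy_Ai 0 = c * deriv airy_Ai (0 * c)"
    using fun_cong[OF airy_solution_rotate(2)[OF airy_Ai_solution assms(1)], of 0] by simp
  then show False
    using airy_coeff_nonzero(2) assms(2) by (simp add: airy_Ai_deriv_0)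
qed

theorem theorem5:
  "(\<forall>w :: complex \<Rightarrow> complex.
      airy_solution w \<longrightarrow> \<not> (\<forall>z. w z = 0) \<longrightarrow>
      \<not> (\<exists>c. \<forall>z. w z = c * airy_Ai z) \<longrightarrow>
      \<not> (\<exists>c. \<forall>z. w z = c * airy_Ai (z * cis (2 * pi / 3))) \<longrightarrow>
      \<not> (\<exists>c. \<forall>z. w z = c * airy_Ai (z * cis (- 2 * pi / 3))) \<longrightarrow>
      zeros_tend_to_ray w (- pi) \<and> zeros_tend_to_ray w (pi / 3) \<and> zeros_tend_to_ray w (- pi / 3))
   \<and> zeros_only_on_ray airy_Ai pi
   \<and> zeros_only_on_ray (\<lambda>z. airy_Ai (z * cis (2 * pi / 3))) (pi / 3)
   \<and> zeros_only_on_ray (\<lambda>z. airy_Ai (z * cis (- 2 * pi / 3))) (- pi / 3)"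
proof -
  let ?\<omega> = "cis (2 * pi / 3)" and ?\<omega>' = "cis (- 2 * pi / 3)"
  have tend_pi: "zeros_tend_to_ray w pi \<longleftrightarrow> zeros_tend_to_ray w (- pi)" for w
    by (simp add: zeros_tend_to_ray_def ray_pi)
  have angles: "pi - 2 * pi / 3 = pi / 3" "- pi - (- 2 * pi / 3) = - pi / 3"
    by simp_all
  have assoc: "z * a * b = z * (a * b)" for z a b :: complex
    by (rule mult.assoc)
  \<comment> \<open>For each of the other two rays, the solution is rotated so that the ray becomes the negative axis;
    the rotation permutes the three exceptional functions.\<close>
  have generic: "zeros_tend_to_ray w (- pi) \<and> zeros_tend_to_ray w (pi / 3) \<and> zeros_tend_to_ray w (- pi / 3)"
    if w: "airy_solution w"
      and n0: "\<nexists>c. \<forall>z. w z = c * airy_Ai z"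
      and n1: "\<nexists>c. \<forall>z. w z = c * airy_Ai (z * ?\<omega>)"
      and n2: "\<nexists>c. \<forall>z. w z = c * airy_Ai (z * ?\<omega>')" for w
  proof (intro conjI)
    show "zeros_tend_to_ray w (- pi)"
      by (rule zeros_near_negative_axis_unless_multiple[OF w n1 n2])
    have "zeros_tend_to_ray (\<lambda>z. w (z * ?\<omega>')) (- pi)"
    proof (rule zeros_near_negative_axis_unless_multiple)
      show "airy_solution (\<lambda>z. w (z * ?\<omega>'))"
        by (intro airy_solution_rotate(1)[OF w] cube_root_facts)
      show "\<nexists>c. \<forall>z. w (z * ?\<omega>') = c * airy_Ai (z * ?\<omega>)"
      proof
        assume "\<exists>c. \<forall>z. w (z * ?\<omega>') = c * airy_Ai (z * ?\<omega>)"
        then obtain c where c: "\<And>z. w (z * ?\<omega>') = c * airy_Ai (z * ?\<omega>)" by blast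
        have "w z = c * airy_Ai (z * ?\<omega>')" for z
          using c[of "z * ?\<omega>"] by (simp only: assoc cube_root_facts mult_1_right)
        then show False using n2 by blast
      qed
      show "\<nexists>c. \<forall>z. w (z * ?\<omega>') = c * airy_Ai (z * ?\<omega>')"
      proof
        assume "\<exists>c. \<forall>z. w (z * ?\<omega>') = c * airy_Ai (z * ?\<omega>')"
        then obtain c where c: "\<And>z. w (z * ?\<omega>') = c * airy_Ai (z * ?\<omega>')" by blast
        have "w z = c * airy_Ai z" for z
          using c[of "z * ?\<omega>"] by (simp only: assoc cube_root_facts mult_1_right)
        then show False using n0 by blast
      qed
    qed
    then have "zeros_tend_to_ray (\<lambda>z. w (z * ?\<omega> * ?\<omega>')) (pi - 2 * pi / 3)"
      unfolding tend_pi [symmetric] by (rule zeros_tend_to_ray_rotate)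
    then show "zeros_tend_to_ray w (pi / 3)"
      by (simp only: assoc cube_root_facts mult_1_right angles)
    have "zeros_tend_to_ray (\<lambda>z. w (z * ?\<omega>)) (- pi)"
    proof (rule zeros_near_negative_axis_unless_multiple)
      show "airy_solution (\<lambda>z. w (z * ?\<omega>))"
        by (intro airy_solution_rotate(1)[OF w] cube_root_facts)
      show "\<nexists>c. \<forall>z. w (z * ?\<omega>) = c * airy_Ai (z * ?\<omega>)"
      proof
        assume "\<exists>c. \<forall>z. w (z * ?\<omega>) = c * airy_Ai (z * ?\<omega>)"
        then obtain c where c: "\<And>z. w (z * ?\<omega>) = c * airy_Ai (z * ?\<omega>)" by blast
        have "w z = c * airy_Ai z" for z
          using c[of "z * ?\<omega>'"] by (simp only: assoc cube_root_facts mult_1_right)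
        then show False using n0 by blast
      qed
      show "\<nexists>c. \<forall>z. w (z * ?\<omega>) = c * airy_Ai (z * ?\<omega>')"
      proof
        assume "\<exists>c. \<forall>z. w (z * ?\<omega>) = c * airy_Ai (z * ?\<omega>')"
        then obtain c where c: "\<And>z. w (z * ?\<omega>) = c * airy_Ai (z * ?\<omega>')" by blast
        have "w z = c * airy_Ai (z * ?\<omega>)" for z
          using c[of "z * ?\<omega>'"] by (simp only: assoc cube_root_facts mult_1_right)
        then show False using n1 by blast
      qed
    qed
    then have "zeros_tend_to_ray (\<lambda>z. w (z * ?\<omega>' * ?\<omega>)) (- pi - (- 2 * pi / 3))"
      by (rule zeros_tend_to_ray_rotate)
    then show "zeros_tend_to_ray w (- pi / 3)"
      by (simp only: assoc cube_root_facts mult_1_right angles)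
  qed
  have Ai: "zeros_tend_to_ray airy_Ai (- pi)"
    by (intro zeros_near_negative_axis_unless_multiple airy_Ai_solution
        airy_Ai_not_multiple_of_rotation cube_root_facts)
  have "zeros_only_on_ray airy_Ai pi"
    using Ai airy_Ai_zeros by (auto simp: zeros_only_on_ray_def tend_pi)
  moreover have "zeros_only_on_ray (\<lambda>z. airy_Ai (z * ?\<omega>)) (pi / 3)"
    using zeros_tend_to_ray_rotate[OF Ai[folded tend_pi], of "2 * pi / 3"] airy_Ai_rotated_zeros(1)
    unfolding zeros_only_on_ray_def angles by blast
  moreover have "zeros_only_on_ray (\<lambda>z. airy_Ai (z * ?\<omega>')) (- pi / 3)"
    using zeros_tend_to_ray_rotate[OF Ai, of "- 2 * pi / 3"] airy_Ai_rotated_zeros(2)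
    unfolding zeros_only_on_ray_def angles by blast
  ultimately show ?thesis using generic by blast
qed

end
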